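(* Let $\mathcal{A}\in\mathbb{R}^{m\times\ell\times n}$, $\mathcal{B}\in\mathbb{R}^{m\times q\times n}$, $p\in(0,1)$, let $\mathcal{W}\subset\mathbb{R}^{\ell\times q\times n}$ be a closed convex set, and let $\mathcal{X}_\star\in\mathcal{W}$ satisfy $\mathcal{A}*\mathcal{X}_\star=\mathcal{B}$. Suppose the missing data model is the uniform missing model, the column block missing model, or the frontal slice missing model (defined in the context), let $\mathcal{D}$ be a random binary mask under the chosen model, and let $\tilde{\mathcal{A}}=\mathcal{D}\circ\mathcal{A}$. Suppose the Row Assumption (stated in the context) holds, and let $F(\mathcal{X})=\frac{1}{2m}\|\mathcal{A}*\mathcal{X}-\mathcal{B}\|^2$. Let $R=\max_{\mathcal{W}_1\in\mathcal{W}}\|\mathcal{W}_1\|$ and let $K$ be a constant with $\sup_{\mathcal{W}_1,\mathcal{W}_2\in\mathcal{W}}\|\mathcal{W}_1-\mathcal{W}_2\|\le K$. Let $(\mathcal{X}^t)$ denote the iterates of the algorithm mSGDT (defined in the context). (1) If $\alpha_t=C/\sqrt{t}$ for $t\ge1$ with a constant $C>0$ (and $\alpha_0>0$ arbitrary), then for all $t\ge1$ $$\mathbb{E}\big[F(\mathcal{X}^{t})-F(\mathcal{X}_\star)\big]\le\Big(\frac{K^2}{C}+CG\Big)\frac{2+\log(t)}{\sqrt{t}},$$ where $$G=\frac{4n^2R^2}{p^3m}\sum_{i=0}^{m-1}\|\mathcal{A}_{i::}\|^4+\frac{4n^{3/2}R}{p^2m}\sum_{i=0}^{m-1}\|\mathcal{A}_{i::}\|^3\|\mathcal{B}_{i::}\|+\frac{2n}{p^2m}\sum_{i=0}^{m-1}\|\mathcal{A}_{i::}\|^2\|\mathcal{B}_{i::}\|^2.$$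 (2) Suppose furthermore that $F$ is $\mu$-strongly convex for some $\mu>0$. Let $L_g=na_{\max}^2/p^2$, where $a_{\max}=\max_{0\le i<m}\|\mathcal{A}_{i::}\|$, and let $G_\star=\frac{4n^2R^2}{p^3m}\sum_{i=0}^{m-1}\|\mathcal{A}_{i::}\|^4$. If the step size is fixed, $\alpha_t=\alpha$ with $0<\alpha<1/L_g$, then for all $t>0$ $$\mathbb{E}\big[\|\mathcal{X}^{t}-\mathcal{X}_\star\|^2\big]\le r^t\|\mathcal{X}^0-\mathcal{X}_\star\|^2+\frac{\alpha G_\star}{\mu(1-\alpha L_g)},\qquad\text{where } r:=1-2\alpha\mu(1-\alpha L_g).$$
   Context: Tensors are real, third-order and zero-indexed: $\mathcal{A}\in\mathbb{R}^{m\times\ell\times n}$ has entries $\mathcal{A}_{ijk}$, $0\le i<m$, $0\le j<\ell$, $0\le k<n$. $\mathcal{A}_{i::}\in\mathbb{R}^{1\times\ell\times n}$ is the $i$th row slice, and $\mathbf{A}_k\in\mathbb{R}^{m\times\ell}$ is the $k$th frontal slice $\mathcal{A}_{::k}$ viewed as a matrix. For $\mathcal{X}\in\mathbb{R}^{\ell\times q\times n}$, the t-product $\mathcal{A}*\mathcal{X}\in\mathbb{R}^{m\times q\times n}$ is the tensor with frontal slices $(\mathcal{A}*\mathcal{X})_{::k}=\sum_{s=0}^{n-1}\mathbf{A}_{(k-s)\bmod n}\mathbf{X}_s$. The transpose $\mathcal{A}^T\in\mathbb{R}^{\ell\times m\times n}$ has $k$th frontal slice $\mathbf{A}_{(-k)\bmod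 n}^T$; $\mathcal{A}_{i::}^T$ means $(\mathcal{A}_{i::})^T$. $\circ$ is the entrywise product; $\langle\mathcal{A},\mathcal{B}\rangle=\sum_{i,j,k}\mathcal{A}_{ijk}\mathcal{B}_{ijk}$ and $\|\mathcal{A}\|=\sqrt{\langle\mathcal{A},\mathcal{A}\rangle}$ (Frobenius norm), also for slices. Missing data: a random binary mask $\mathcal{D}\in\{0,1\}^{m\times\ell\times n}$ indicates the observed entries, $\tilde{\mathcal{A}}=\mathcal{D}\circ\mathcal{A}$. $\mathbb{E}_{\mathcal{D}}$ is expectation over the mask, $\mathbb{E}_i$ is expectation over $i$ uniform on $\{0,\dots,m-1\}$. The three models: - Uniform missing model: the entries of $\mathcal{D}$ are i.i.d. Bernoulli($p$). - Column block missing model: $b$ is a divisor of $\ell$; the column blocks $\mathcal{D}_{i,\,0:b-1,\,:},\ \mathcal{D}_{i,\,b:2b-1,\,:},\dots$ of each row slice of $\mathcal{D}$ are i.i.d., each equal to the all-ones tensor with probability $p$ and to the zero tensor with probability $1-p$. - Frontal slice missing model: the frontal slices $\mathcal{D}_{i:k}$ ($0\le k<n$) of each row slice of $\mathcal{D}$ are i.i.d., each equal to the all-ones tensor with probability $p$ and to the zero tensor with probability $1-p$. Correction tensor $\mathcal{C}\in\{0,1\}^{\ell\times\ell\times n}$ used for each model: uniform: $\mathcal{C}_{xyk}=1$ iff $k=0$ and $x=y$; column block: $\mathcal{C}_{xyk}=1$ iff $\lfloor x/b\rfloor=\lfloor y/b\rfloor$ (every frontal slice is block diagonal with $b\times b$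 blocks of ones); frontal slice: $\mathcal{C}_{xyk}=1$ iff $k=0$. Update function: for row index $i$ and mask $\mathcal{D}$, $$g(\mathcal{X})=\frac{1}{p^2}\Big(\tilde{\mathcal{A}}_{i::}^T*(\tilde{\mathcal{A}}_{i::}*\mathcal{X}-p\,\mathcal{B}_{i::})\Big)-\frac{1-p}{p^2}\big(\mathcal{C}\circ(\tilde{\mathcal{A}}_{i::}^T*\tilde{\mathcal{A}}_{i::})\big)*\mathcal{X}.$$ Algorithm mSGDT: start from $\mathcal{X}^0\in\mathbb{R}^{\ell\times q\times n}$; for $t=0,1,2,\dots$ choose a row index $i\in\{0,\dots,m-1\}$ uniformly at random, compute $g(\mathcal{X}^t)$ with this $i$ and the current mask, and set $\mathcal{X}^{t+1}=\mathcal{P}_{\mathcal{W}}(\mathcal{X}^t-\alpha_t g(\mathcal{X}^t))$, where $\mathcal{P}_{\mathcal{W}}$ is the Frobenius-norm projection onto $\mathcal{W}$. $\mathbb{E}$ without subscript is expectation over all row choices and masks. Row Assumption: either every row $\mathcal{A}_{i::}$ is chosen at most once during the algorithm, or the mask is redrawn at each iteration. It is used in the sense that, conditionally on the previous iterations, the row index at the current iteration is uniform on $\{0,\dots,m-1\}$ and the mask on the chosen row is distributed as a fresh draw of $\mathcal{D}$, so that the conditional expectation of a function of $g$ at the current iterate is $\mathbb{E}_i\mathbb{E}_{\mathcal{D}}$. *)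

theory Defs
  imports
    "HOL-Analysis.Analysis"
    "HOL-Probability.Probability"
    "Berlekamp_Zassenhaus.Finite_Field"
begin

text \<open>
  A real tensor of size \<open>m \<times> l \<times> n\<close> is a nested vector with entries \<open>A $ i $ j $ k\<close>, so that the
  library's \<open>norm\<close> is the Frobenius norm, and \<open>closed\<close>, \<open>convex\<close> and \<open>closest_point\<close> have their
  Euclidean meaning. The third index ranges over \<open>'n mod_ring\<close>, that is, over \<open>0, \<dots>, CARD('n) - 1\<close>
  with addition, subtraction and negation modulo \<open>CARD('n)\<close>; this works for every size.
  The first two index types are arbitrary finite types; they are specialised to \<open>'l mod_ring\<close>
  where the position of a column matters.
\<close>

type_synonym ('m, 'l, 'n) tensor = "((real, 'n mod_ring) vec, 'l) vec ^ 'm"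

definition frontal :: "('m::finite, 'l::finite, 'n::finite) tensor \<Rightarrow> 'n mod_ring \<Rightarrow> real ^ 'l ^ 'm"
  where "frontal A k = (\<chi> i j. A $ i $ j $ k)"

definition row_slice :: "('m::finite, 'l::finite, 'n::finite) tensor \<Rightarrow> 'm \<Rightarrow> (1, 'l, 'n) tensor"
  where "row_slice A i = (\<chi> _. A $ i)"

definition tprod :: "('m::finite, 'l::finite, 'n::finite) tensor \<Rightarrow> ('l, 'q::finite, 'n) tensor
    \<Rightarrow> ('m, 'q, 'n) tensor"  (infixl "\<star>" 70)
  where "A \<star> X = (\<chi> i j k. (\<Sum>s\<in>UNIV. frontal A (k - s) ** frontal X s) $ i $ j)"

definition ttranspose :: "('m::finite, 'l::finite, 'n::finite) tensor \<Rightarrow> ('l, 'm, 'n) tensor"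
  where "ttranspose A = (\<chi> i j k. transpose (frontal A (- k)) $ i $ j)"

definition hadamard :: "('m::finite, 'l::finite, 'n::finite) tensor \<Rightarrow> ('m, 'l, 'n) tensor
    \<Rightarrow> ('m, 'l, 'n) tensor"
  where "hadamard D A = (\<chi> i j k. D $ i $ j $ k * A $ i $ j $ k)"


text \<open>The argument of \<open>Column_Block\<close> is the block width.\<close>

datatype missing_model = Uniform_Missing | Column_Block nat | Frontal_Slice

definition col :: "'l::finite mod_ring \<Rightarrow> nat"
  where "col j = nat (to_int_mod_ring j)"

text \<open>The \<open>c\<close>-th column block of width \<open>b\<close>, padded by zeros to the full number of columns.\<close>

definition column_block :: "nat \<Rightarrow> nat \<Rightarrow> ('m::finite, 'l::finite mod_ring, 'n::finite) tensor
    \<Rightarrow> ('m, 'l mod_ring, 'n) tensor"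
  where "column_block b c S = (\<chi> i j k. if col j div b = c then S $ i $ j $ k else 0)"

text \<open>
  \<open>missing_law model p Q\<close>: the distribution \<open>Q\<close> of a random mask follows the missing data model
  with parameter \<open>p\<close>. Masks are tensors with entries 0 and 1. Note that \<open>1\<close> at a vector type denotes the
  all-ones vector (not an identity matrix). In the last two models, the blocks and slices are independent
  within each row slice; nothing is required about the dependence between different row slices.
\<close>

fun missing_law :: "missing_model \<Rightarrow> real \<Rightarrow> ('m::finite, 'l::finite mod_ring, 'n::finite) tensor pmf \<Rightarrow> bool"
  where
    "missing_law Uniform_Missing p Q \<longleftrightarrow>
       prob_space.indep_vars (measure_pmf Q) (\<lambda>_. count_space UNIV)
         (\<lambda>(i, j, k) D. D $ i $ j $ k) UNIV \<and>
       (\<forall>i j k. map_pmf (\<lambda>D. D $ i $ j $ k) Q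
          = map_pmf (\<lambda>x. if x then 1 else 0) (bernoulli_pmf p))"
  | "missing_law (Column_Block b) p Q \<longleftrightarrow>
       b dvd CARD('l) \<and>
       (\<forall>i. prob_space.indep_vars (measure_pmf Q) (\<lambda>_. count_space UNIV)
              (\<lambda>c D. column_block b c (row_slice D i)) {..<CARD('l) div b} \<and>
            (\<forall>c<CARD('l) div b. map_pmf (\<lambda>D. column_block b c (row_slice D i)) Q
               = map_pmf (\<lambda>x. if x then column_block b c 1 else 0) (bernoulli_pmf p)))"
  | "missing_law Frontal_Slice p Q \<longleftrightarrow>
       (\<forall>i. prob_space.indep_vars (measure_pmf Q) (\<lambda>_. count_space UNIV)
              (\<lambda>k D. frontal (row_slice D i) k) UNIV \<and>
            (\<forall>k. map_pmf (\<lambda>D. frontal (row_slice D i) k) Q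
               = map_pmf (\<lambda>x. if x then 1 else 0) (bernoulli_pmf p)))"

fun correction :: "missing_model \<Rightarrow> ('l::finite mod_ring, 'l mod_ring, 'n::finite) tensor"
  where
    "correction Uniform_Missing = (\<chi> x y k. if k = 0 \<and> x = y then 1 else 0)"
  | "correction (Column_Block b) = (\<chi> x y k. if col x div b = col y div b then 1 else 0)"
  | "correction Frontal_Slice = (\<chi> x y k. if k = 0 then 1 else 0)"


definition grad_update :: "real \<Rightarrow> ('l::finite, 'l, 'n::finite) tensor
    \<Rightarrow> ('m::finite, 'l, 'n) tensor \<Rightarrow> ('m, 'q::finite, 'n) tensor
    \<Rightarrow> 'm \<Rightarrow> ('m, 'l, 'n) tensor \<Rightarrow> ('l, 'q, 'n) tensor \<Rightarrow> ('l, 'q, 'n) tensor"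
  where "grad_update p Cor A B i D X =
    (let Ai = row_slice (hadamard D A) i; Bi = row_slice B i in
      (1 / p\<^sup>2) *\<^sub>R (ttranspose Ai \<star> (Ai \<star> X - p *\<^sub>R Bi))
      - ((1 - p) / p\<^sup>2) *\<^sub>R (hadamard Cor (ttranspose Ai \<star> Ai) \<star> X))"

text \<open>
  The iterates along one realisation \<open>I\<close> of the row choices and \<open>D\<close> of the masks, with step
  sizes \<open>\<alpha>\<close>.
\<close>

primrec msgdt :: "real \<Rightarrow> ('l::finite, 'l, 'n::finite) tensor
    \<Rightarrow> ('m::finite, 'l, 'n) tensor \<Rightarrow> ('m, 'q::finite, 'n) tensor \<Rightarrow> ('l, 'q, 'n) tensor set
    \<Rightarrow> ('l, 'q, 'n) tensor \<Rightarrow> (nat \<Rightarrow> real) \<Rightarrow> (nat \<Rightarrow> 'm) \<Rightarrow> (nat \<Rightarrow> ('m, 'l, 'n) tensor)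
    \<Rightarrow> nat \<Rightarrow> ('l, 'q, 'n) tensor"
  where
    "msgdt p Cor A B W X0 \<alpha> I D 0 = X0"
  | "msgdt p Cor A B W X0 \<alpha> I D (Suc t) =
       (let X = msgdt p Cor A B W X0 \<alpha> I D t in
         closest_point W (X - \<alpha> t *\<^sub>R grad_update p Cor A B (I t) (D t) X))"

text \<open>
  \<open>I t\<close> and \<open>D t\<close> are the row index and the mask at iteration \<open>t\<close>. Conditionally on the rows
  chosen before, together with the masks on these rows, the current row index is uniform and the mask on
  the chosen row is distributed as the corresponding row slice of a fresh draw from \<open>Q\<close>.
  Histories range over finitely many values almost surely, so elementary conditional probabilities
  determine the conditional law.
\<close>

definition row_assumption :: "'w measure \<Rightarrow> (nat \<Rightarrow> 'w \<Rightarrow> 'm::finite)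
    \<Rightarrow> (nat \<Rightarrow> 'w \<Rightarrow> ('m, 'l::finite, 'n::finite) tensor) \<Rightarrow> ('m, 'l, 'n) tensor pmf \<Rightarrow> bool"
  where "row_assumption M I D Q \<longleftrightarrow>
    (\<forall>t. I t \<in> measurable M (count_space UNIV)) \<and>
    (\<forall>t. D t \<in> borel_measurable M) \<and>
    (\<forall>t i d h. \<P>(\<omega> in M. \<forall>s<t. (I s \<omega>, row_slice (D s \<omega>) (I s \<omega>)) = h s) > 0 \<longrightarrow>
       \<P>(\<omega> in M. I t \<omega> = i \<and> row_slice (D t \<omega>) (I t \<omega>) = d
           \<bar> \<forall>s<t. (I s \<omega>, row_slice (D s \<omega>) (I s \<omega>)) = h s)
         = 1 / real CARD('m) * pmf (map_pmf (\<lambda>D'. row_slice D' i) Q) d)"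

definition loss :: "('m::finite, 'l::finite, 'n::finite) tensor \<Rightarrow> ('m, 'q::finite, 'n) tensor
    \<Rightarrow> ('l, 'q, 'n) tensor \<Rightarrow> real"
  where "loss A B X = 1 / (2 * real CARD('m)) * (norm (A \<star> X - B))\<^sup>2"

definition strongly_convex :: "real \<Rightarrow> ('a::real_normed_vector \<Rightarrow> real) \<Rightarrow> bool"
  where "strongly_convex \<mu> f \<longleftrightarrow>
    (\<forall>x y u. 0 \<le> u \<and> u \<le> 1 \<longrightarrow>
       f (u *\<^sub>R x + (1 - u) *\<^sub>R y)
         \<le> u * f x + (1 - u) * f y - \<mu> / 2 * u * (1 - u) * (norm (x - y))\<^sup>2)"

end

theory Submission
  imports Defs
begin

text \<open>
  The update \<open>g\<close> is an unbiased estimate of the gradient of the loss \<open>F\<close>. Two mask entries of one row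
  have expected product \<open>p\<close> if they lie in the same block and \<open>p\<^sup>2\<close> otherwise, and the correction tensor is the
  indicator of the first case: the product of mask entries that enters position \<open>(x, y, k)\<close> of the masked Gram
  tensor has a mean that depends only on the correction entry at \<open>(x, y, k)\<close>
  (\<open>expectation_debiased_gram\<close>). Each mask entry is 0 or 1, so a masked row is never longer than the row and
  has mean squared norm \<open>p\<close> times that of the row. With the bound \<open>\<parallel>A * X\<parallel> \<le> sqrt n \<parallel>A\<parallel> \<parallel>X\<parallel>\<close> this controls
  the second moment of \<open>g\<close> (\<open>second_moment_grad_update\<close>).

  Under the row assumption the pairs (row index, mask on this row) are independent with a common law of
  finite support. Expectations over the iterates are therefore expectations over lists of such pairs
  (\<open>expectation_msgdt\<close>), where conditioning on the past is just splitting off the head of the list. What remains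
  is projected stochastic gradient descent with unbiased gradients of bounded second moment.

  The first claim is the last-iterate bound of Shamir and Zhang. The one-step inequality for the mean squared
  distance holds for any reference point of \<open>W\<close> that is determined by the past. Comparing with the
  iterate at time \<open>T - k\<close> bounds how much the average loss over the last \<open>k\<close> iterates exceeds the average over the
  last \<open>k + 1\<close>; summing these gaps produces the logarithm (\<open>last_iterate_rate\<close>). The point \<open>X0\<close> may lie outside
  \<open>W\<close>, so all this starts at time 1.

  For the second claim, \<open>B = A * Xstar\<close> bounds the rows of \<open>B\<close> by those of \<open>A\<close>, and \<open>G_star\<close> then bounds the second
  moment of \<open>g\<close> on all of \<open>W\<close>, not just at \<open>Xstar\<close>. Strong convexity makes one step contract the mean squared
  distance by \<open>1 - 2 \<alpha> \<mu> \<le> r\<close> up to \<open>\<alpha>\<^sup>2 G_star\<close>, which is at most \<open>1 - r\<close> times the claimed additive term. The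
  first step starts from an arbitrary \<open>X0\<close>, where the second moment may exceed \<open>G_star\<close>. Unless \<open>X0\<close> is
  far from \<open>Xstar\<close>, the slack in the additive term absorbs the excess; if it is,
  the squared diameter bound \<open>4 R\<^sup>2\<close> for the distance after the projection is already below the right-hand side
  (\<open>first_step_bound\<close>).
\<close>

section \<open>Algebra and norm bounds for the t-product\<close>

lemma tprod_nth:
  "(A \<star> X) $ i $ j $ k = (\<Sum>s\<in>UNIV. \<Sum>t\<in>UNIV. A $ i $ t $ (k - s) * X $ t $ j $ s)"
  by (simp add: tprod_def frontal_def matrix_matrix_mult_def)

lemma ttranspose_nth [simp]: "ttranspose A $ i $ j $ k = A $ j $ i $ (- k)"
  by (simp add: ttranspose_def frontal_def transpose_def)

lemma hadamard_nth [simp]: "hadamard D A $ i $ j $ k = D $ i $ j $ k * A $ i $ j $ k"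
  by (simp add: hadamard_def)

lemma row_slice_nth [simp]: "row_slice A i $ u = A $ i"
  by (simp add: row_slice_def)

lemma inner_tensor: "inner A B = (\<Sum>i\<in>UNIV. \<Sum>j\<in>UNIV. \<Sum>k\<in>UNIV. A $ i $ j $ k * B $ i $ j $ k)"
  for A B :: "('m::finite, 'l::finite, 'n::finite) tensor"
  by (simp add: inner_vec_def)

lemma norm_tensor_sq: "(norm A)\<^sup>2 = (\<Sum>i\<in>UNIV. \<Sum>j\<in>UNIV. \<Sum>k\<in>UNIV. (A $ i $ j $ k)\<^sup>2)"
  for A :: "('m::finite, 'l::finite, 'n::finite) tensor"
  unfolding power2_norm_eq_inner inner_tensor by (simp add: power2_eq_square)

lemma sum_shift: "(\<Sum>s\<in>UNIV. f (k - s)) = (\<Sum>s\<in>UNIV. f s)"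
  for f :: "'a::{finite, ab_group_add} \<Rightarrow> 'b::comm_monoid_add"
  by (rule sum.reindex_bij_witness[of _ "\<lambda>s. k - s" "\<lambda>s. k - s"]) auto

lemma tprod_add_left: "(A + A') \<star> X = A \<star> X + A' \<star> X"
  by (simp add: vec_eq_iff tprod_nth sum.distrib distrib_right)

lemma tprod_scaleR_left: "(c *\<^sub>R A) \<star> X = c *\<^sub>R (A \<star> X)"
  by (simp add: vec_eq_iff tprod_nth sum_distrib_left mult.assoc)

lemma tprod_add_right: "A \<star> (X + Y) = A \<star> X + A \<star> Y"
  by (simp add: vec_eq_iff tprod_nth sum.distrib distrib_left)

lemma tprod_scaleR_right: "A \<star> (c *\<^sub>R X) = c *\<^sub>R (A \<star> X)"
  by (simp add: vec_eq_iff tprod_nth sum_distrib_left mult_ac)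

lemma tprod_diff_left: "(A - A') \<star> X = A \<star> X - A' \<star> X"
  by (simp add: vec_eq_iff tprod_nth sum_subtractf left_diff_distrib)

lemma tprod_diff_right: "A \<star> (X - Y) = A \<star> X - A \<star> Y"
  by (simp add: vec_eq_iff tprod_nth sum_subtractf right_diff_distrib)

lemma linear_tprod_left: "linear (\<lambda>A. A \<star> X)"
  by (intro linearI tprod_add_left tprod_scaleR_left)

lemma row_slice_tprod: "row_slice (A \<star> X) i = row_slice A i \<star> X"
  by (simp add: vec_eq_iff tprod_nth)

lemma row_slice_diff: "row_slice (A - B) i = row_slice A i - row_slice B i"
  by (simp add: vec_eq_iff)

text \<open>
  Entrywise, both sides are a convolution over the cyclic index and a matrix product over the inner
  indices; a cyclic shift of the convolution variable matches them.
\<close>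

lemma tprod_assoc: "(A \<star> B) \<star> X = A \<star> (B \<star> X)"
proof -
  have "(\<Sum>s\<in>UNIV. \<Sum>t\<in>UNIV. (\<Sum>r\<in>UNIV. \<Sum>u\<in>UNIV. A $ i $ u $ (k - s - r) * B $ u $ t $ r) * X $ t $ j $ s)
    = (\<Sum>r\<in>UNIV. \<Sum>u\<in>UNIV. A $ i $ u $ (k - r) * (\<Sum>s\<in>UNIV. \<Sum>t\<in>UNIV. B $ u $ t $ (r - s) * X $ t $ j $ s))"
    (is "?L = ?R") for i j k
  proof -
    have "?L = (\<Sum>s\<in>UNIV. \<Sum>r\<in>UNIV. \<Sum>u\<in>UNIV. \<Sum>t\<in>UNIV. A $ i $ u $ (k - s - r) * B $ u $ t $ r * X $ t $ j $ s)"
      unfolding sum_distrib_right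
      by (rule sum.cong[OF refl], subst sum.swap, rule sum.cong[OF refl], subst sum.swap, rule refl)
    also have "\<dots> = (\<Sum>s\<in>UNIV. \<Sum>r\<in>UNIV. \<Sum>u\<in>UNIV. \<Sum>t\<in>UNIV. A $ i $ u $ (k - r) * B $ u $ t $ (r - s) * X $ t $ j $ s)"
    proof (rule sum.cong[OF refl], goal_cases)
      case (1 s)
      show ?case
        by (rule sum.reindex_bij_witness[of _ "\<lambda>r. r - s" "\<lambda>r. r + s"]) (auto simp: algebra_simps)
    qed
    also have "\<dots> = (\<Sum>r\<in>UNIV. \<Sum>s\<in>UNIV. \<Sum>u\<in>UNIV. \<Sum>t\<in>UNIV. A $ i $ u $ (k - r) * B $ u $ t $ (r - s) * X $ t $ j $ s)"
      by (rule sum.swap)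
    also have "\<dots> = ?R"
      unfolding sum_distrib_left mult.assoc
      by (rule sum.cong[OF refl], subst sum.swap, rule refl)
    finally show ?thesis .
  qed
  then show ?thesis by (simp add: vec_eq_iff tprod_nth)
qed

text \<open>
  The cyclic reversal in the transpose is what makes it the adjoint for the Frobenius inner
  product.
\<close>

lemma inner_ttranspose_tprod: "inner (ttranspose A \<star> Y) V = inner Y (A \<star> V)"
proof -
  have "inner (ttranspose A \<star> Y) V
     = (\<Sum>x\<in>UNIV. \<Sum>j\<in>UNIV. \<Sum>k\<in>UNIV. \<Sum>s\<in>UNIV. \<Sum>t\<in>UNIV. A $ t $ x $ (s - k) * Y $ t $ j $ s * V $ x $ j $ k)"
    by (simp add: inner_tensor tprod_nth sum_distrib_right)
  also have "\<dots> = (\<Sum>x\<in>UNIV. \<Sum>j\<in>UNIV. \<Sum>s\<in>UNIV. \<Sum>t\<in>UNIV. \<Sum>k\<in>UNIV. A $ t $ x $ (s - k) * Y $ t $ j $ s * V $ x $ j $ k)"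
    by (rule sum.cong[OF refl], rule sum.cong[OF refl], subst sum.swap, rule sum.cong[OF refl], rule sum.swap)
  also have "\<dots> = (\<Sum>x\<in>UNIV. \<Sum>j\<in>UNIV. \<Sum>t\<in>UNIV. \<Sum>s\<in>UNIV. \<Sum>k\<in>UNIV. A $ t $ x $ (s - k) * Y $ t $ j $ s * V $ x $ j $ k)"
    by (rule sum.cong[OF refl], rule sum.cong[OF refl], rule sum.swap)
  also have "\<dots> = (\<Sum>x\<in>UNIV. \<Sum>t\<in>UNIV. \<Sum>j\<in>UNIV. \<Sum>s\<in>UNIV. \<Sum>k\<in>UNIV. A $ t $ x $ (s - k) * Y $ t $ j $ s * V $ x $ j $ k)"
    by (rule sum.cong[OF refl], rule sum.swap)
  also have "\<dots> = (\<Sum>t\<in>UNIV. \<Sum>x\<in>UNIV. \<Sum>j\<in>UNIV. \<Sum>s\<in>UNIV. \<Sum>k\<in>UNIV. A $ t $ x $ (s - k) * Y $ t $ j $ s * V $ x $ j $ k)"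
    by (rule sum.swap)
  also have "\<dots> = (\<Sum>t\<in>UNIV. \<Sum>j\<in>UNIV. \<Sum>x\<in>UNIV. \<Sum>s\<in>UNIV. \<Sum>k\<in>UNIV. A $ t $ x $ (s - k) * Y $ t $ j $ s * V $ x $ j $ k)"
    by (rule sum.cong[OF refl], rule sum.swap)
  also have "\<dots> = (\<Sum>t\<in>UNIV. \<Sum>j\<in>UNIV. \<Sum>s\<in>UNIV. \<Sum>k\<in>UNIV. \<Sum>x\<in>UNIV. A $ t $ x $ (s - k) * Y $ t $ j $ s * V $ x $ j $ k)"
    by (rule sum.cong[OF refl], rule sum.cong[OF refl], subst sum.swap, rule sum.cong[OF refl], rule sum.swap)
  also have "\<dots> = inner Y (A \<star> V)"
    by (simp add: inner_tensor tprod_nth sum_distrib_left mult_ac)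
  finally show ?thesis .
qed

text \<open>
  Each entry of the product is an inner product of a rearranged row slice with a column slice. Summing
  the squared Cauchy--Schwarz bounds meets every pair of row and column once for each of the \<open>n\<close> frontal slices,
  which gives the factor \<open>sqrt n\<close>.
\<close>

lemma norm_tprod_le:
  fixes A :: "('m::finite, 'l::finite, 'n::finite) tensor" and X :: "('l, 'q::finite, 'n) tensor"
  shows "norm (A \<star> X) \<le> sqrt (real CARD('n)) * norm A * norm X"
proof -
  define a where "a i = (\<Sum>t\<in>UNIV. \<Sum>s\<in>UNIV. (A $ i $ t $ s)\<^sup>2)" for i
  define x where "x j = (\<Sum>t\<in>UNIV. \<Sum>s\<in>UNIV. (X $ t $ j $ s)\<^sup>2)" for j
  have entry: "((A \<star> X) $ i $ j $ k)\<^sup>2 \<le> a i * x j" for i j k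
  proof -
    have "(A \<star> X) $ i $ j $ k = (\<Sum>z\<in>UNIV \<times> UNIV. A $ i $ snd z $ (k - fst z) * X $ snd z $ j $ fst z)"
      by (simp add: tprod_nth sum.cartesian_product case_prod_beta)
    also have "(\<dots>)\<^sup>2 \<le> (\<Sum>z\<in>UNIV \<times> UNIV. (A $ i $ snd z $ (k - fst z))\<^sup>2)
        * (\<Sum>z\<in>UNIV \<times> UNIV. (X $ snd z $ j $ fst z)\<^sup>2)"
      by (rule Cauchy_Schwarz_ineq_sum)
    also have "\<dots> = (\<Sum>s\<in>UNIV. \<Sum>t\<in>UNIV. (A $ i $ t $ (k - s))\<^sup>2) * (\<Sum>s\<in>UNIV. \<Sum>t\<in>UNIV. (X $ t $ j $ s)\<^sup>2)"
      by (simp add: sum.cartesian_product case_prod_beta)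
    also have "\<dots> = a i * x j"
      unfolding a_def x_def
      by (subst (1 2) sum.swap) (simp add: sum_shift[of "\<lambda>s. (A $ i $ _ $ s)\<^sup>2" k])
    finally show ?thesis .
  qed
  have "(norm (A \<star> X))\<^sup>2 \<le> (\<Sum>i\<in>UNIV. \<Sum>j\<in>UNIV. \<Sum>k\<in>(UNIV :: 'n mod_ring set). a i * x j)"
    unfolding norm_tensor_sq by (intro sum_mono entry)
  also have "\<dots> = real CARD('n) * (\<Sum>i\<in>UNIV. a i) * (\<Sum>j\<in>UNIV. x j)"
    by (simp add: mult.assoc sum_product[of a] flip: sum_distrib_left)
  also have "(\<Sum>i\<in>UNIV. a i) = (norm A)\<^sup>2"
    by (simp add: a_def norm_tensor_sq)
  also have "(\<Sum>j\<in>UNIV. x j) = (norm X)\<^sup>2"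
    unfolding x_def norm_tensor_sq by (rule sum.swap)
  also have "real CARD('n) * (norm A)\<^sup>2 * (norm X)\<^sup>2 = (sqrt (real CARD('n)) * norm A * norm X)\<^sup>2"
    by (simp add: power_mult_distrib)
  finally show ?thesis
    by (rule power2_le_imp_le) simp
qed

lemma norm_ttranspose [simp]: "norm (ttranspose A) = norm A"
proof -
  have "(\<Sum>i\<in>UNIV. \<Sum>j\<in>UNIV. \<Sum>k\<in>UNIV. (A $ j $ i $ (- k))\<^sup>2) = (\<Sum>j\<in>UNIV. \<Sum>i\<in>UNIV. \<Sum>k\<in>UNIV. (A $ j $ i $ k)\<^sup>2)"
    using sum_shift[of "\<lambda>k. (A $ _ $ _ $ k)\<^sup>2" 0] by (subst sum.swap) simp
  then have "(norm (ttranspose A))\<^sup>2 = (norm A)\<^sup>2" by (simp add: norm_tensor_sq)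
  then show ?thesis by simp
qed

lemma norm_hadamard_le:
  assumes "\<And>i j k. \<bar>C $ i $ j $ k\<bar> \<le> 1"
  shows "norm (hadamard C T) \<le> norm T"
proof -
  have "(C $ i $ j $ k * T $ i $ j $ k)\<^sup>2 \<le> (T $ i $ j $ k)\<^sup>2" for i j k
    using mult_right_mono[OF assms[of i j k], of "\<bar>T $ i $ j $ k\<bar>"]
    by (intro abs_le_square_iff[THEN iffD1]) (simp add: abs_mult)
  then have "(norm (hadamard C T))\<^sup>2 \<le> (norm T)\<^sup>2"
    by (simp add: norm_tensor_sq sum_mono)
  then show ?thesis by (rule power2_le_imp_le) simp
qed

lemma norm_row_slice_sq: "(norm (row_slice A i))\<^sup>2 = (\<Sum>j\<in>UNIV. \<Sum>k\<in>UNIV. (A $ i $ j $ k)\<^sup>2)"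
  by (simp add: norm_tensor_sq)

lemma sum_norm_row_slice_sq: "(\<Sum>i\<in>UNIV. (norm (row_slice A i))\<^sup>2) = (norm A)\<^sup>2"
  unfolding norm_row_slice_sq unfolding norm_tensor_sq ..

lemma sum_inner_row_slice: "(\<Sum>i\<in>UNIV. inner (row_slice A i) (row_slice B i)) = inner A B"
  by (simp add: inner_tensor)

section \<open>Moments of random masks\<close>

text \<open>
  Common core of the three models: the mask is cut into independent blocks \<open>V c\<close>, each of which is
  \<open>on c\<close> or \<open>off c\<close>, and \<open>f\<close>, \<open>f'\<close> read one entry each. Entries of one block agree almost surely, entries of
  different blocks are independent.
\<close>

lemma block_entry_moments:
  fixes V :: "'c \<Rightarrow> 'd \<Rightarrow> 'e"
  assumes p: "0 \<le> p" "p \<le> 1"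
    and indep: "prob_space.indep_vars (measure_pmf Q) (\<lambda>_. count_space UNIV) V J"
    and law: "\<And>c. c \<in> J \<Longrightarrow> map_pmf (V c) Q = map_pmf (\<lambda>x. if x then on c else off c) (bernoulli_pmf p)"
    and c: "c \<in> J" "f (on c) = 1" "f (off c) = (0::real)"
    and c': "c' \<in> J" "f' (on c') = 1" "f' (off c') = (0::real)"
  shows "D \<in> set_pmf Q \<Longrightarrow> f (V c D) = 0 \<or> f (V c D) = 1"
    and "measure_pmf.expectation Q (\<lambda>D. f (V c D) * f' (V c' D)) = (if c = c' then p else p\<^sup>2)"
proof -
  have supp: "g (V d D) = 0 \<or> g (V d D) = (1::real)" 
    if "D \<in> set_pmf Q" "d \<in> J" "g (on d) = 1" "g (off d) = 0" for g d D
  proof -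
    have "V d D \<in> set_pmf (map_pmf (V d) Q)" using that by simp
    then show ?thesis unfolding law[OF that(2)] using that by (auto split: if_splits)
  qed
  show "D \<in> set_pmf Q \<Longrightarrow> f (V c D) = 0 \<or> f (V c D) = 1" by (rule supp) (use c in auto)
  have mean: "measure_pmf.expectation Q (\<lambda>D. g (V d D)) = p"
    if "d \<in> J" "g (on d) = 1" "g (off d) = (0::real)" for g d
  proof -
    have "measure_pmf.expectation Q (\<lambda>D. g (V d D)) = measure_pmf.expectation (map_pmf (V d) Q) g"
      by simp
    also have "\<dots> = p" unfolding law[OF that(1)] using p that by simp
    finally show ?thesis .
  qed
  show "measure_pmf.expectation Q (\<lambda>D. f (V c D) * f' (V c' D)) = (if c = c' then p else p\<^sup>2)"
  proof (cases "c = c'")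
    case True
    then show ?thesis using mean[of c "\<lambda>v. f v * f' v"] c c' by simp
  next
    case False
    define Y where "Y d = (if d = c then f else f')" for d
    have J: "{c, c'} \<subseteq> J" using c c' by simp
    have int: "integrable (measure_pmf Q) (\<lambda>D. Y d (V d D))" if "d \<in> {c, c'}" for d
    proof (rule measure_pmf.integrable_const_bound[where B = 1])
      show "AE D in measure_pmf Q. norm (Y d (V d D)) \<le> 1"
        using supp[of _ c f] supp[of _ c' f'] c c' that by (fastforce simp: AE_measure_pmf_iff Y_def)
    qed simp
    have "prob_space.indep_vars (measure_pmf Q) (\<lambda>_. borel) (\<lambda>d D. Y d (V d D)) {c, c'}"
      by (rule prob_space.indep_vars_compose2[OF prob_space_measure_pmf
            prob_space.indep_vars_subset[OF prob_space_measure_pmf indep J]]) simp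
    from prob_space.indep_vars_lebesgue_integral[OF prob_space_measure_pmf _ this int]
    have "measure_pmf.expectation Q (\<lambda>D. Y c (V c D) * Y c' (V c' D))
       = measure_pmf.expectation Q (\<lambda>D. Y c (V c D)) * measure_pmf.expectation Q (\<lambda>D. Y c' (V c' D))"
      using False by simp
    then show ?thesis using False mean[of c f] mean[of c' f'] c c'
      by (simp add: Y_def power2_eq_square)
  qed
qed

text \<open>
  What the analysis uses of a missing data model. The index \<open>v - u\<close> is the frontal slice of the Gram
  tensor to which the product of the entries at \<open>(x, u)\<close> and \<open>(y, v)\<close> contributes.
\<close>

definition mask_moments :: "real \<Rightarrow> ('l::finite, 'l, 'n::finite) tensor \<Rightarrow> ('m::finite, 'l, 'n) tensor pmf \<Rightarrow> bool"
  where "mask_moments p C Q \<longleftrightarrow>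
    (\<forall>D\<in>set_pmf Q. \<forall>i j k. D $ i $ j $ k = 0 \<or> D $ i $ j $ k = 1) \<and>
    (\<forall>x y k. C $ x $ y $ k = 0 \<or> C $ x $ y $ k = 1) \<and> (\<forall>x. C $ x $ x $ 0 = 1) \<and>
    (\<forall>i x u y v. measure_pmf.expectation Q (\<lambda>D. D $ i $ x $ u * D $ i $ y $ v)
       = (if C $ x $ y $ (v - u) = 1 then p else p\<^sup>2))"

lemma col_less: "col (j :: 'l::finite mod_ring) < CARD('l)"
proof -
  have "to_int_mod_ring j \<in> {0..<int CARD('l)}"
    using range_to_int_mod_ring[where 'a = 'l] by blast
  then show ?thesis by (auto simp: col_def)
qed

text \<open>
  In each model the correction tensor records when two entries of a row slice share a block: same
  entry, same column block, or same frontal slice.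
\<close>

lemma missing_law_moments:
  fixes Q :: "('m::finite, 'l::finite mod_ring, 'n::finite) tensor pmf"
  assumes p: "0 < p" "p < 1" and law: "missing_law model p Q"
  shows "mask_moments p (correction model) Q"
proof (cases model)
  case Uniform_Missing
  let ?V = "\<lambda>(i, j, k) D. (D :: ('m, 'l mod_ring, 'n) tensor) $ i $ j $ k"
  have ind: "prob_space.indep_vars (measure_pmf Q) (\<lambda>_. count_space UNIV) ?V UNIV"
    and lw: "map_pmf (?V c) Q = map_pmf (\<lambda>x. if x then 1 else 0) (bernoulli_pmf p)" for c
    using law Uniform_Missing by (auto split: prod.splits)
  note m = block_entry_moments[where f = "\<lambda>z. z" and f' = "\<lambda>z. z", OF _ _ ind lw]
  have "D $ i $ j $ k = 0 \<or> D $ i $ j $ k = 1" if "D \<in> set_pmf Q" for D i j k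
    using m(1)[of "(i, j, k)" "(i, j, k)"] that p by simp
  moreover have "measure_pmf.expectation Q (\<lambda>D. D $ i $ x $ u * D $ i $ y $ v)
      = (if x = y \<and> v = u then p else p\<^sup>2)" for i x u y v
    using m(2)[of "(i, x, u)" "(i, y, v)"] p by auto
  ultimately show ?thesis unfolding mask_moments_def Uniform_Missing by auto
next
  case (Column_Block b)
  have b: "b dvd CARD('l)" using law Column_Block by simp
  then have "b > 0" by (rule dvd_pos_nat[rotated]) simp
  have blk: "col x div b < CARD('l) div b" for x :: "'l mod_ring"
    using col_less[of x] b \<open>b > 0\<close> by (metis dvd_div_mult_self less_mult_imp_div_less)
  let ?V = "\<lambda>i c D. column_block b c (row_slice (D :: ('m, 'l mod_ring, 'n) tensor) i)"
  have ind: "prob_space.indep_vars (measure_pmf Q) (\<lambda>_. count_space UNIV) (?V i) {..<CARD('l) div b}"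
    and lw: "c \<in> {..<CARD('l) div b} \<Longrightarrow>
       map_pmf (?V i c) Q = map_pmf (\<lambda>x. if x then column_block b c 1 else 0) (bernoulli_pmf p)" for i c
    using law Column_Block by auto
  have entry: "D $ i $ x $ u = ?V i (col x div b) D $ 1 $ x $ u" for D i x u
    by (simp add: column_block_def)
  have one: "column_block b (col x div b) (1 :: (1, 'l mod_ring, 'n) tensor) $ 1 $ x $ u = 1" for x u
    by (simp add: column_block_def)
  note m = block_entry_moments[OF _ _ ind lw]
  have "D $ i $ x $ u = 0 \<or> D $ i $ x $ u = 1" if "D \<in> set_pmf Q" for D i x u
    unfolding entry using p blk that one by (intro m(1)[where c' = "col x div b" and f = "\<lambda>z. z $ 1 $ x $ u" and f' = "\<lambda>z. z $ 1 $ x $ u"]) auto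
  moreover have "measure_pmf.expectation Q (\<lambda>D. D $ i $ x $ u * D $ i $ y $ v)
      = (if col x div b = col y div b then p else p\<^sup>2)" for i x u y v
    unfolding entry[of _ _ x] entry[of _ _ y] using p blk one
    by (intro m(2)[where f = "\<lambda>z. z $ 1 $ x $ u" and f' = "\<lambda>z. z $ 1 $ y $ v"]) auto
  ultimately show ?thesis unfolding mask_moments_def Column_Block by auto
next
  case Frontal_Slice
  let ?V = "\<lambda>i k D. frontal (row_slice (D :: ('m, 'l mod_ring, 'n) tensor) i) k"
  have ind: "prob_space.indep_vars (measure_pmf Q) (\<lambda>_. count_space UNIV) (?V i) UNIV"
    and lw: "map_pmf (?V i k) Q = map_pmf (\<lambda>x. if x then 1 else 0) (bernoulli_pmf p)" for i k
    using law Frontal_Slice by auto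
  have entry: "D $ i $ x $ u = ?V i u D $ 1 $ x" for D i x u
    by (simp add: frontal_def)
  note m = block_entry_moments[OF _ _ ind lw]
  have "D $ i $ x $ u = 0 \<or> D $ i $ x $ u = 1" if "D \<in> set_pmf Q" for D i x u
    unfolding entry using p that by (intro m(1)[where c' = u and f = "\<lambda>z. z $ 1 $ x" and f' = "\<lambda>z. z $ 1 $ x"]) auto
  moreover have "measure_pmf.expectation Q (\<lambda>D. D $ i $ x $ u * D $ i $ y $ v)
      = (if u = v then p else p\<^sup>2)" for i x u y v
    unfolding entry[of _ _ x] entry[of _ _ y] using p
    by (intro m(2)[where f = "\<lambda>z. z $ 1 $ x" and f' = "\<lambda>z. z $ 1 $ y"]) auto
  ultimately show ?thesis unfolding mask_moments_def Frontal_Slice by auto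
qed

lemma mask_moments_finite:
  fixes Q :: "('m::finite, 'l::finite, 'n::finite) tensor pmf"
  assumes "mask_moments p C Q"
  shows "finite (set_pmf Q)"
proof (rule finite_subset)
  let ?E = "PiE (UNIV :: ('m \<times> 'l \<times> 'n mod_ring) set) (\<lambda>_. {0, 1 :: real})"
  show "finite ((\<lambda>f. \<chi> i j k. f (i, j, k)) ` ?E)"
    by (intro finite_imageI finite_PiE) auto
  show "set_pmf Q \<subseteq> (\<lambda>f. \<chi> i j k. f (i, j, k)) ` ?E"
  proof
    fix D assume "D \<in> set_pmf Q"
    then have "(\<lambda>(i, j, k). D $ i $ j $ k) \<in> ?E"
      using assms by (auto simp: mask_moments_def PiE_iff)
    then show "D \<in> (\<lambda>f. \<chi> i j k. f (i, j, k)) ` ?E"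
      by (intro image_eqI[where x = "\<lambda>(i, j, k). D $ i $ j $ k"]) (simp_all add: vec_eq_iff)
  qed
qed

section \<open>The stochastic gradient\<close>

lemma integral_tensor_nth:
  fixes f :: "'w \<Rightarrow> ('m::finite, 'l::finite, 'n::finite) tensor"
  assumes "integrable M f"
  shows "(LINT \<omega>|M. f \<omega>) $ i $ j $ k = (LINT \<omega>|M. f \<omega> $ i $ j $ k)"
proof -
  have bl: "bounded_linear (\<lambda>T. (T :: ('m, 'l, 'n) tensor) $ i $ j $ k)"
    by (intro bounded_linear_compose[OF bounded_linear_vec_nth]
        bounded_linear_compose[OF bounded_linear_vec_nth] bounded_linear_vec_nth)
  show ?thesis using integral_bounded_linear[OF bl assms] by simp
qed

text \<open>
  By associativity the update is affine in \<open>X\<close> with the corrected Gram tensor as its linear part, so only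
  this tensor and the masked row have to be averaged.
\<close>

lemma grad_update_eq:
  assumes "p \<noteq> 0"
  shows "grad_update p C A B i D X =
    (let a = row_slice (hadamard D A) i; S = ttranspose a \<star> a in
      (1 / p\<^sup>2) *\<^sub>R ((S - (1 - p) *\<^sub>R hadamard C S) \<star> X) - (1 / p) *\<^sub>R (ttranspose a \<star> row_slice B i))"
  using assms
  by (simp add: grad_update_def Let_def tprod_diff_left tprod_diff_right tprod_scaleR_left
      tprod_scaleR_right tprod_assoc scaleR_diff_right power2_eq_square)

context
  fixes p :: real and C :: "('l::finite, 'l, 'n::finite) tensor" and Q :: "('m::finite, 'l, 'n) tensor pmf"
    and A :: "('m, 'l, 'n) tensor" and B :: "('m, 'q::finite, 'n) tensor"
  assumes p: "0 < p" "p < 1" and mask: "mask_moments p C Q"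
begin

lemma mask_integrable: "integrable (measure_pmf Q) f"
  for f :: "('m, 'l, 'n) tensor \<Rightarrow> 'x::{banach, second_countable_topology}"
  by (intro integrable_measure_pmf_finite mask_moments_finite[OF mask])

lemma mask_entry: "D \<in> set_pmf Q \<Longrightarrow> D $ i $ j $ k = 0 \<or> D $ i $ j $ k = 1"
  using mask by (simp add: mask_moments_def)

lemma expectation_mask_product:
  "measure_pmf.expectation Q (\<lambda>D. D $ i $ x $ u * D $ i $ y $ v) = (if C $ x $ y $ (v - u) = 1 then p else p\<^sup>2)"
  using mask by (simp add: mask_moments_def)

text \<open>A 0/1 entry equals its square, so this is the diagonal case of the product moments.\<close>

lemma expectation_mask_entry: "measure_pmf.expectation Q (\<lambda>D. D $ i $ x $ u) = p"
proof -
  have "measure_pmf.expectation Q (\<lambda>D. D $ i $ x $ u) = measure_pmf.expectation Q (\<lambda>D. D $ i $ x $ u * D $ i $ x $ u)"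
    using mask_entry by (intro integral_cong_AE) (auto simp: AE_measure_pmf_iff)
  then show ?thesis using mask unfolding expectation_mask_product by (simp add: mask_moments_def)
qed

text \<open>
  Off the correction pattern a product of mask entries has mean \<open>p\<^sup>2\<close>. On the pattern it has mean \<open>p\<close>,
  and subtracting the fraction \<open>1 - p\<close> of it leaves \<open>p\<^sup>2\<close> as well.
\<close>

lemma expectation_debiased_gram:
  fixes i :: 'm
  defines "S \<equiv> \<lambda>D. ttranspose (row_slice (hadamard D A) i) \<star> row_slice (hadamard D A) i"
  shows "measure_pmf.expectation Q (\<lambda>D. S D - (1 - p) *\<^sub>R hadamard C (S D))
    = p\<^sup>2 *\<^sub>R (ttranspose (row_slice A i) \<star> row_slice A i)"
proof -
  have C01: "C $ x $ y $ k = 0 \<or> C $ x $ y $ k = 1" for x y k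
    using mask by (simp add: mask_moments_def)
  have "measure_pmf.expectation Q (\<lambda>D. (S D - (1 - p) *\<^sub>R hadamard C (S D)) $ x $ y $ k)
     = p\<^sup>2 * (ttranspose (row_slice A i) \<star> row_slice A i) $ x $ y $ k" for x y k
  proof -
    have "(S D - (1 - p) *\<^sub>R hadamard C (S D)) $ x $ y $ k
      = (\<Sum>s\<in>UNIV. (1 - (1 - p) * C $ x $ y $ k) * A $ i $ x $ (s - k) * A $ i $ y $ s
           * (D $ i $ x $ (s - k) * D $ i $ y $ s))" for D
    proof -
      have "S D $ x $ y $ k = (\<Sum>s\<in>UNIV. A $ i $ x $ (s - k) * A $ i $ y $ s * (D $ i $ x $ (s - k) * D $ i $ y $ s))"
        by (simp add: S_def tprod_nth mult_ac)
      then have "(S D - (1 - p) *\<^sub>R hadamard C (S D)) $ x $ y $ k = (1 - (1 - p) * C $ x $ y $ k) *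
          (\<Sum>s\<in>UNIV. A $ i $ x $ (s - k) * A $ i $ y $ s * (D $ i $ x $ (s - k) * D $ i $ y $ s))"
        by (simp add: algebra_simps)
      then show ?thesis by (simp add: sum_distrib_left mult.assoc)
    qed
    then have "measure_pmf.expectation Q (\<lambda>D. (S D - (1 - p) *\<^sub>R hadamard C (S D)) $ x $ y $ k)
      = (\<Sum>s\<in>UNIV. (1 - (1 - p) * C $ x $ y $ k) * A $ i $ x $ (s - k) * A $ i $ y $ s
           * (if C $ x $ y $ k = 1 then p else p\<^sup>2))"
      by (simp add: Bochner_Integration.integral_sum mask_integrable expectation_mask_product)
    also have "\<dots> = (\<Sum>s\<in>UNIV. p\<^sup>2 * (A $ i $ x $ (s - k) * A $ i $ y $ s))"
      using C01[of x y k] by (intro sum.cong) (auto simp: power2_eq_square)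
    finally show ?thesis by (simp add: tprod_nth sum_distrib_left)
  qed
  then show ?thesis
    by (simp add: vec_eq_iff integral_tensor_nth mask_integrable)
qed

lemma expectation_masked_row:
  "measure_pmf.expectation Q (\<lambda>D. ttranspose (row_slice (hadamard D A) i)) = p *\<^sub>R ttranspose (row_slice A i)"
  by (simp add: vec_eq_iff integral_tensor_nth mask_integrable expectation_mask_entry)

lemma expectation_tprod_left:
  "measure_pmf.expectation Q (\<lambda>D. T D \<star> Y) = measure_pmf.expectation Q T \<star> Y"
proof -
  have "bounded_linear (\<lambda>T. T \<star> Y)"
    using linear_tprod_left by (simp add: linear_conv_bounded_linear)
  from integral_bounded_linear[OF this mask_integrable] show ?thesis .
qed

lemma expectation_grad_update:
  "measure_pmf.expectation Q (\<lambda>D. grad_update p C A B i D X)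
    = ttranspose (row_slice A i) \<star> (row_slice A i \<star> X - row_slice B i)"
proof -
  have "p \<noteq> 0" using p by simp
  then show ?thesis
    by (simp add: grad_update_eq Let_def mask_integrable expectation_tprod_left
        expectation_debiased_gram expectation_masked_row tprod_scaleR_left tprod_assoc tprod_diff_right)
qed

lemma expectation_norm_masked_row_sq:
  "measure_pmf.expectation Q (\<lambda>D. (norm (row_slice (hadamard D A) i))\<^sup>2) = p * (norm (row_slice A i))\<^sup>2"
proof -
  have "measure_pmf.expectation Q (\<lambda>D. (norm (row_slice (hadamard D A) i))\<^sup>2)
     = measure_pmf.expectation Q (\<lambda>D. \<Sum>j\<in>UNIV. \<Sum>k\<in>UNIV. D $ i $ j $ k * D $ i $ j $ k * (A $ i $ j $ k)\<^sup>2)"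
    unfolding norm_row_slice_sq by (simp add: power2_eq_square mult_ac)
  also have "\<dots> = (\<Sum>j\<in>UNIV. \<Sum>k\<in>UNIV. p * (A $ i $ j $ k)\<^sup>2)"
    using mask by (simp add: Bochner_Integration.integral_sum mask_integrable expectation_mask_product mask_moments_def)
  finally show ?thesis unfolding norm_row_slice_sq by (simp add: sum_distrib_left)
qed

lemma norm_masked_row_le:
  assumes "D \<in> set_pmf Q"
  shows "norm (row_slice (hadamard D A) i) \<le> norm (row_slice A i)"
proof -
  have "row_slice (hadamard D A) i = hadamard (row_slice D i) (row_slice A i)"
    by (simp add: vec_eq_iff)
  moreover have "\<bar>row_slice D i $ u $ j $ k\<bar> \<le> 1" for u j k
    using mask_entry[OF assms, of i j k] by auto
  ultimately show ?thesis by (metis norm_hadamard_le)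
qed

text \<open>
  The Gram tensor of a masked row of norm \<open>a\<close> has norm at most \<open>sqrt n * a\<^sup>2\<close>, and the entrywise product
  with a 0/1 tensor does not increase it. The corrected Gram tensor thus costs a factor \<open>1 + (1 - p)\<close>.
\<close>

lemma norm_grad_update_le:
  fixes D :: "('m, 'l, 'n) tensor" and i :: 'm
  defines "a \<equiv> norm (row_slice (hadamard D A) i)"
  shows "norm (grad_update p C A B i D X)
    \<le> a * ((2 - p) / p\<^sup>2 * real CARD('n) * a * norm X + sqrt (real CARD('n)) / p * norm (row_slice B i))"
proof -
  define T where "T = row_slice (hadamard D A) i"
  define S where "S = ttranspose T \<star> T"
  define c where "c = sqrt (real CARD('n))"
  have c: "c \<ge> 0" "c * c = real CARD('n)" by (simp_all add: c_def)
  have a: "norm T = a" "a \<ge> 0" by (simp_all add: a_def T_def)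
  have nS: "norm S \<le> c * a * a"
    unfolding S_def using norm_tprod_le[of "ttranspose T" T] by (simp add: a c_def)
  have "\<bar>C $ x $ y $ k\<bar> \<le> 1" for x y k
  proof -
    have "C $ x $ y $ k = 0 \<or> C $ x $ y $ k = 1"
      using mask by (simp add: mask_moments_def)
    then show ?thesis by auto
  qed
  then have "norm (hadamard C S) \<le> norm S" by (rule norm_hadamard_le)
  then have nCS: "norm (hadamard C S) \<le> c * a * a" using nS by simp
  have "norm (S - (1 - p) *\<^sub>R hadamard C S) \<le> norm S + (1 - p) * norm (hadamard C S)"
    using norm_triangle_ineq4[of S "(1 - p) *\<^sub>R hadamard C S"] p by simp
  also have "\<dots> \<le> c * a * a + (1 - p) * (c * a * a)"
    using nS nCS p by (intro add_mono mult_left_mono) auto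
  finally have nM: "norm (S - (1 - p) *\<^sub>R hadamard C S) \<le> (2 - p) * (c * a * a)"
    by (simp add: algebra_simps)
  have "norm ((S - (1 - p) *\<^sub>R hadamard C S) \<star> X) \<le> c * norm (S - (1 - p) *\<^sub>R hadamard C S) * norm X"
    unfolding c_def by (rule norm_tprod_le)
  also have "\<dots> \<le> c * ((2 - p) * (c * a * a)) * norm X"
    using c nM by (intro mult_right_mono mult_left_mono) auto
  also have "\<dots> = (2 - p) * (c * c) * a * a * norm X" by simp
  finally have 1: "norm ((S - (1 - p) *\<^sub>R hadamard C S) \<star> X) \<le> (2 - p) * (c * c) * a * a * norm X" .
  have 2: "norm (ttranspose T \<star> row_slice B i) \<le> c * a * norm (row_slice B i)"
    using norm_tprod_le[of "ttranspose T" "row_slice B i"] by (simp add: a c_def)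
  have g: "grad_update p C A B i D X
     = (1 / p\<^sup>2) *\<^sub>R ((S - (1 - p) *\<^sub>R hadamard C S) \<star> X) - (1 / p) *\<^sub>R (ttranspose T \<star> row_slice B i)"
    using p by (simp add: grad_update_eq Let_def S_def T_def)
  have "norm (grad_update p C A B i D X)
     \<le> 1 / p\<^sup>2 * norm ((S - (1 - p) *\<^sub>R hadamard C S) \<star> X) + 1 / p * norm (ttranspose T \<star> row_slice B i)"
    unfolding g by (rule order_trans[OF norm_triangle_ineq4]) (use p in simp)
  also have "\<dots> \<le> 1 / p\<^sup>2 * ((2 - p) * (c * c) * a * a * norm X) + 1 / p * (c * a * norm (row_slice B i))"
    using 1 2 p by (intro add_mono mult_left_mono) auto
  also have "\<dots> = a * ((2 - p) / p\<^sup>2 * real CARD('n) * a * norm X + c / p * norm (row_slice B i))"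
    unfolding c(2) using p by (simp add: field_simps power2_eq_square)
  finally show ?thesis by (simp add: c_def)
qed

text \<open>
  The pointwise bound is \<open>a\<close> times an increasing function of the norm \<open>a\<close> of the masked row. In that
  function \<open>a\<close> may be replaced by the norm of the full row, and the remaining \<open>a\<^sup>2\<close> gains a factor \<open>p\<close> in the mean.
\<close>

lemma second_moment_grad_update:
  fixes i :: 'm
  defines "a \<equiv> \<lambda>i. norm (row_slice A i)"
  shows "measure_pmf.expectation Q (\<lambda>D. (norm (grad_update p C A B i D X))\<^sup>2)
    \<le> p * (a i)\<^sup>2 * ((2 - p) / p\<^sup>2 * real CARD('n) * a i * norm X + sqrt (real CARD('n)) / p * norm (row_slice B i))\<^sup>2"
proof -
  define b where "b z = (2 - p) / p\<^sup>2 * real CARD('n) * z * norm X + sqrt (real CARD('n)) / p * norm (row_slice B i)" for z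
  define m where "m D = norm (row_slice (hadamard D A) i)" for D
  have b: "0 \<le> b z" if "z \<ge> 0" for z using that p by (simp add: b_def)
  have "(norm (grad_update p C A B i D X))\<^sup>2 \<le> (m D)\<^sup>2 * (b (a i))\<^sup>2" if "D \<in> set_pmf Q" for D
  proof -
    have "norm (grad_update p C A B i D X) \<le> m D * b (m D)"
      unfolding b_def m_def by (rule norm_grad_update_le)
    also have "\<dots> \<le> m D * b (a i)"
      using norm_masked_row_le[OF that, of i] p unfolding b_def m_def a_def
      by (intro mult_left_mono add_right_mono mult_right_mono) auto
    finally have "(norm (grad_update p C A B i D X))\<^sup>2 \<le> (m D * b (a i))\<^sup>2"
      by (rule power_mono) simp
    then show ?thesis by (simp add: power_mult_distrib)
  qed
  then have "measure_pmf.expectation Q (\<lambda>D. (norm (grad_update p C A B i D X))\<^sup>2)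
      \<le> measure_pmf.expectation Q (\<lambda>D. (m D)\<^sup>2 * (b (a i))\<^sup>2)"
    by (intro integral_mono_AE mask_integrable) (simp add: AE_measure_pmf_iff)
  also have "\<dots> = p * (a i)\<^sup>2 * (b (a i))\<^sup>2"
    by (simp add: m_def a_def expectation_norm_masked_row_sq)
  finally show ?thesis unfolding b_def .
qed

end

section \<open>The last iterate: real sequences\<close>

lemma sum_inverse_sqrt_le:
  assumes "1 \<le> s" "s \<le> T"
  shows "(\<Sum>t=s..T. 1 / sqrt (real t)) \<le> 2 * (sqrt (real T) - sqrt (real (s - 1)))"
proof -
  have step_le: "1 / sqrt (real t) \<le> 2 * (sqrt (real t) - sqrt (real (t - 1)))" if "t \<ge> 1" for t
  proof -
    define x y where "x = sqrt (real t)" and "y = sqrt (real (t - 1))"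
    have sq: "x\<^sup>2 = y\<^sup>2 + 1" "x > 0" "y \<ge> 0"
      using that by (auto simp: x_def y_def of_nat_diff)
    have "1 \<le> 2 * (x - y) * x" using sq zero_le_power2[of "x - y"]
      by (simp add: power2_eq_square algebra_simps)
    then show ?thesis using sq(2) unfolding x_def[symmetric] y_def[symmetric]
      by (simp add: field_simps)
  qed
  show ?thesis using assms(2)
  proof (induction T rule: dec_induct)
    case base
    show ?case using step_le[OF assms(1)] by simp
  next
    case (step n)
    then show ?case using step_le[of "Suc n"] assms(1) by simp
  qed
qed

lemma sqrt_diff_le:
  assumes "1 \<le> s" "s \<le> T"
  shows "sqrt (real T) - sqrt (real (s - 1)) \<le> real (T - s + 1) / sqrt (real T)"
proof -
  define x y where "x = sqrt (real T)" and "y = sqrt (real (s - 1))"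
  have sq: "x\<^sup>2 - y\<^sup>2 = real (T - s + 1)" "x > 0" "y \<ge> 0" "y \<le> x"
    using assms by (auto simp: x_def y_def of_nat_diff)
  have "(x - y) * x \<le> x\<^sup>2 - y\<^sup>2"
    using mult_right_mono[OF sq(4,3)] by (simp add: power2_eq_square algebra_simps)
  then show ?thesis using sq(2) unfolding sq(1) x_def[symmetric] y_def[symmetric]
    by (simp add: field_simps)
qed

text \<open>
  Dividing the one-step inequality by the step size and summing by parts: the weights \<open>1 / a t\<close> increase,
  and the distances \<open>d t\<close> that they multiply stay below \<open>H\<close>.
\<close>

lemma weighted_regret:
  fixes a d f :: "nat \<Rightarrow> real"
  assumes d: "\<And>t. s \<le> t \<Longrightarrow> 0 \<le> d t" "\<And>t. s \<le> t \<Longrightarrow> d t \<le> H"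
    and rec: "\<And>t. s \<le> t \<Longrightarrow> d (Suc t) \<le> d t - 2 * a t * f t + (a t)\<^sup>2 * G"
    and a: "\<And>t. s \<le> t \<Longrightarrow> 0 < a t" "\<And>t. s \<le> t \<Longrightarrow> a (Suc t) \<le> a t"
    and "s \<le> T"
  shows "(\<Sum>t=s..T. f t) \<le> d s / (2 * a s) + H / 2 * (1 / a T - 1 / a s) + G / 2 * (\<Sum>t=s..T. a t)
      - d (Suc T) / (2 * a T)"
  using \<open>s \<le> T\<close>
proof (induction T rule: dec_induct)
  have f: "f t \<le> d t / (2 * a t) - d (Suc t) / (2 * a t) + G / 2 * a t" if "s \<le> t" for t
    using rec[OF that] a(1)[OF that] by (simp add: field_simps power2_eq_square)
  {
    case base
    show ?case using f[of s] by simp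
  next
    case (step n)
    have "(d (Suc n)) * (1 / a (Suc n) - 1 / a n) \<le> H * (1 / a (Suc n) - 1 / a n)"
      using step(1) a(1)[of n] a(1)[of "Suc n"] a(2)[of n]
      by (intro mult_right_mono d(2)) (auto simp: frac_le)
    then have "d (Suc n) / (2 * a (Suc n)) - d (Suc n) / (2 * a n) \<le> H / 2 * (1 / a (Suc n) - 1 / a n)"
      by (simp add: field_simps)
    then show ?case using step f[of "Suc n"] by (simp add: algebra_simps)
  }
qed

text \<open>
  The last-iterate argument of Shamir and Zhang, reduced to real sequences: \<open>f t\<close> is the expected
  optimality gap, \<open>e t\<close> the mean squared distance to the minimiser and \<open>d s t\<close> the mean squared distance between
  the iterates at times \<open>s\<close> and \<open>t\<close>.
\<close>

lemma last_iterate_rate: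
  fixes f :: "nat \<Rightarrow> real" and d :: "nat \<Rightarrow> nat \<Rightarrow> real"
  assumes C: "C > 0" and a: "\<And>t. t \<ge> 1 \<Longrightarrow> a t = C / sqrt (real t)"
    and H: "H \<ge> 0" and G: "G \<ge> 0"
    and e: "\<And>t. t \<ge> 1 \<Longrightarrow> 0 \<le> e t" "\<And>t. t \<ge> 1 \<Longrightarrow> e t \<le> H"
      "\<And>t. t \<ge> 1 \<Longrightarrow> e (Suc t) \<le> e t - 2 * a t * f t + (a t)\<^sup>2 * G"
    and d: "\<And>s t. 1 \<le> s \<Longrightarrow> s \<le> t \<Longrightarrow> 0 \<le> d s t" "\<And>s t. 1 \<le> s \<Longrightarrow> s \<le> t \<Longrightarrow> d s t \<le> H"
      "\<And>s t. 1 \<le> s \<Longrightarrow> s \<le> t \<Longrightarrow> d s (Suc t) \<le> d s t - 2 * a t * (f t - f s) + (a t)\<^sup>2 * G"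
      "\<And>s. 1 \<le> s \<Longrightarrow> d s s = 0"
    and T: "T \<ge> 1"
  shows "f T \<le> (H / C + C * G) * ((2 + ln (real T)) / sqrt (real T))"
proof -
  have apos: "0 < a t" if "1 \<le> t" for t using that C a by simp
  have adec: "a (Suc t) \<le> a t" if "1 \<le> t" for t
    using that C a[of t] a[of "Suc t"] by (simp add: frac_le)
  define c where "c = H / (2 * C) + C * G"
  have c0: "c \<ge> 0" using H G C by (simp add: c_def)
  have sum_a: "(\<Sum>t=s..T. a t) \<le> 2 * C * (sqrt (real T) - sqrt (real (s - 1)))" if "1 \<le> s" "s \<le> T" for s
  proof -
    have "(\<Sum>t=s..T. a t) = C * (\<Sum>t=s..T. 1 / sqrt (real t))"
      unfolding sum_distrib_left using that by (intro sum.cong) (auto simp: a)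
    also have "\<dots> \<le> C * (2 * (sqrt (real T) - sqrt (real (s - 1))))"
      using C by (intro mult_left_mono sum_inverse_sqrt_le that) auto
    finally show ?thesis by (simp add: mult_ac)
  qed
  have window: "(\<Sum>t=s..T. f t - f s) \<le> c * (real (T - s + 1) / sqrt (real T))" if s: "1 \<le> s" "s \<le> T" for s
  proof -
    have "(\<Sum>t=s..T. f t - f s) \<le> d s s / (2 * a s) + H / 2 * (1 / a T - 1 / a s) + G / 2 * (\<Sum>t=s..T. a t)
      - d s (Suc T) / (2 * a T)"
      using s by (intro weighted_regret) (auto intro!: d apos adec)
    also have "\<dots> \<le> H / 2 * (1 / a T - 1 / a s) + G / 2 * (\<Sum>t=s..T. a t)"
      using d(1)[of s "Suc T"] apos[OF T] d(4)[of s] s by simp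
    also have "\<dots> \<le> H / (2 * C) * (sqrt (real T) - sqrt (real (s - 1)))
        + C * G * (sqrt (real T) - sqrt (real (s - 1)))"
    proof (rule add_mono)
      have "1 / a T - 1 / a s = (sqrt (real T) - sqrt (real s)) / C"
        using a[of T] a[of s] s T by (simp add: diff_divide_distrib)
      also have "\<dots> \<le> (sqrt (real T) - sqrt (real (s - 1))) / C"
        using C by (intro divide_right_mono) auto
      finally have "H / 2 * (1 / a T - 1 / a s) \<le> H / 2 * ((sqrt (real T) - sqrt (real (s - 1))) / C)"
        using H by (intro mult_left_mono) auto
      then show "H / 2 * (1 / a T - 1 / a s) \<le> H / (2 * C) * (sqrt (real T) - sqrt (real (s - 1)))"
        by simp
      show "G / 2 * (\<Sum>t=s..T. a t) \<le> C * G * (sqrt (real T) - sqrt (real (s - 1)))"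
        using mult_left_mono[OF sum_a[OF s], of "G / 2"] G by (simp add: mult_ac)
    qed
    also have "\<dots> = c * (sqrt (real T) - sqrt (real (s - 1)))"
      by (simp add: c_def algebra_simps)
    also have "\<dots> \<le> c * (real (T - s + 1) / sqrt (real T))"
      by (intro mult_left_mono sqrt_diff_le s c0)
    finally show ?thesis .
  qed
  \<comment> \<open>The average of the last \<open>k + 1\<close> values; \<open>S 0\<close> is the last one.\<close>
  define S where "S k = (\<Sum>t=T-k..T. f t) / real (k + 1)" for k
  \<comment> \<open>Comparing with the iterate at time \<open>T - (k + 1)\<close>: it is nearly as bad as the average of its successors.\<close>
  have S_step: "S k \<le> S (Suc k) + c / sqrt (real T) * (1 / real (Suc k))" if "Suc k < T" for k
  proof -
    define s where "s = T - Suc k"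
    have s: "1 \<le> s" "s \<le> T" "Suc s = T - k" "T - s + 1 = k + 2" using that by (auto simp: s_def)
    have split: "(\<Sum>t=s..T. f t) = f s + (\<Sum>t=T-k..T. f t)"
      using s(2) unfolding s(3)[symmetric] by (rule sum.atLeast_Suc_atMost)
    have "(\<Sum>t=s..T. f t - f s) = (\<Sum>t=s..T. f t) - real (k + 2) * f s"
    proof -
      have "card {s..T} = k + 2" using s by simp
      then show ?thesis by (simp only: sum_subtractf sum_constant)
    qed
    with window[OF s(1,2)] have w: "(\<Sum>t=s..T. f t) - real (k + 2) * f s \<le> c * (real (k + 2) / sqrt (real T))"
      unfolding s(4) by simp
    define U where "U = (\<Sum>t=s..T. f t)"
    define q where "q = c / sqrt (real T)"
    have w': "U - (real k + 2) * f s \<le> q * (real k + 2)" using w by (simp add: U_def q_def add.commute)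
    have "S (Suc k) = U / (real k + 2)"
      by (simp add: S_def U_def s_def add.commute)
    then have S1: "S (Suc k) * (real k + 2) = U" by simp
    have "S k = (U - f s) / (real k + 1)"
      using split by (simp add: S_def U_def add.commute)
    then have S0: "S k * (real k + 1) = U - f s" by simp
    have "S (Suc k) * (real k + 2) \<le> (f s + q) * (real k + 2)"
      using w' unfolding S1 by (simp add: algebra_simps)
    then have "S (Suc k) \<le> f s + q" by simp
    moreover have "(S k - S (Suc k)) * (real k + 1) = S (Suc k) - f s"
      using S0 S1 by (simp add: algebra_simps)
    ultimately have "(S k - S (Suc k)) * (real k + 1) \<le> q" by simp
    then show ?thesis unfolding q_def[symmetric] by (simp add: field_simps)
  qed
  have S_chain: "S 0 \<le> S k + c / sqrt (real T) * (\<Sum>j=1..k. 1 / real j)" if "k < T" for k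
    using that
  proof (induction k)
    case (Suc k)
    then show ?case using S_step[of k] by (simp add: algebra_simps)
  qed simp
  have harm: "(\<Sum>j=1..k. 1 / real j) \<le> 1 + ln (real (Suc k))" for k
  proof -
    have "(\<Sum>j=1..k. 1 / real j) \<le> 1 + ln (real k)" if "k \<ge> 1"
      using that
    proof (induction k rule: dec_induct)
      case (step n)
      have "1 / real (Suc n) \<le> ln (real (Suc n)) - ln (real n)"
      proof -
        have "ln (real n / real (Suc n)) \<le> real n / real (Suc n) - 1"
          using step by (intro ln_le_minus_one) auto
        also have "\<dots> = - (1 / real (Suc n))" by (simp add: field_simps)
        finally show ?thesis using step by (simp add: ln_div)
      qed
      then show ?case using step by simp
    qed simp
    moreover have "ln (real k) \<le> ln (real (Suc k))" if "k \<ge> 1" using that by simp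
    ultimately show ?thesis
      by (cases "k \<ge> 1") (linarith, simp)
  qed
  have avg: "S (T - 1) \<le> c / sqrt (real T)"
  proof -
    have "(\<Sum>t=1..T. f t) \<le> e 1 / (2 * a 1) + H / 2 * (1 / a T - 1 / a 1) + G / 2 * (\<Sum>t=1..T. a t)
      - e (Suc T) / (2 * a T)"
      using T by (intro weighted_regret) (auto intro!: e apos adec)
    also have "\<dots> \<le> H / (2 * a 1) + H / 2 * (1 / a T - 1 / a 1) + G / 2 * (\<Sum>t=1..T. a t)"
    proof -
      have "e 1 / (2 * a 1) \<le> H / (2 * a 1)"
        using e(2)[of 1] apos[of 1] by (intro divide_right_mono) auto
      moreover have "0 \<le> e (Suc T) / (2 * a T)"
        using e(1)[of "Suc T"] apos[OF T] by simp
      ultimately show ?thesis by linarith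
    qed
    also have "\<dots> = H / 2 * (1 / a T) + G / 2 * (\<Sum>t=1..T. a t)"
      by (simp add: algebra_simps)
    also have "\<dots> \<le> H / 2 * (sqrt (real T) / C) + G / 2 * (2 * C * sqrt (real T))"
      using sum_a[of 1] T a[of T] G H by (intro add_mono mult_left_mono) auto
    also have "\<dots> = c * sqrt (real T)" by (simp add: c_def field_simps)
    finally have "S (T - 1) \<le> c * sqrt (real T) / real T"
      using T by (simp add: S_def divide_right_mono)
    also have "\<dots> = c / sqrt (real T)"
      using T by (simp add: field_simps)
    finally show ?thesis .
  qed
  have "f T = S 0" by (simp add: S_def)
  also have "\<dots> \<le> c / sqrt (real T) + c / sqrt (real T) * (1 + ln (real T))"
    using S_chain[of "T - 1"] avg mult_left_mono[OF harm[of "T - 1"], of "c / sqrt (real T)"] c0 T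
    by simp
  also have "\<dots> = c * ((2 + ln (real T)) / sqrt (real T))"
    using T by (simp add: field_simps)
  also have "\<dots> \<le> (H / C + C * G) * ((2 + ln (real T)) / sqrt (real T))"
    using T H C by (intro mult_right_mono) (auto simp: c_def field_simps)
  finally show ?thesis .
qed

section \<open>Projected stochastic gradient descent\<close>

text \<open>The projection is nonexpansive and fixes \<open>y\<close>.\<close>

lemma norm_projected_step_sq:
  fixes W :: "'a::euclidean_space set"
  assumes "closed W" "convex W" "y \<in> W"
  shows "(norm (closest_point W (x - c *\<^sub>R v) - y))\<^sup>2
    \<le> (norm (x - y))\<^sup>2 - 2 * c * inner v (x - y) + c\<^sup>2 * (norm v)\<^sup>2"
proof -
  have "dist (closest_point W (x - c *\<^sub>R v)) (closest_point W y) \<le> dist (x - c *\<^sub>R v) y"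
    using assms by (intro closest_point_lipschitz) auto
  then have "norm (closest_point W (x - c *\<^sub>R v) - y) \<le> norm ((x - y) - c *\<^sub>R v)"
    using closest_point_self[OF assms(3)] by (simp add: dist_norm algebra_simps)
  then have "(norm (closest_point W (x - c *\<^sub>R v) - y))\<^sup>2 \<le> (norm ((x - y) - c *\<^sub>R v))\<^sup>2"
    by (simp add: power_mono)
  also have "\<dots> = (norm (x - y))\<^sup>2 - 2 * c * inner v (x - y) + c\<^sup>2 * (norm v)\<^sup>2"
    unfolding power2_norm_eq_inner by (simp add: inner_simps inner_commute power2_eq_square algebra_simps)
  finally show ?thesis .
qed

lemma expectation_bind_finite:
  fixes h :: "'b \<Rightarrow> real"
  assumes "finite (set_pmf p)" "\<And>x. x \<in> set_pmf p \<Longrightarrow> finite (set_pmf (f x))"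
  shows "measure_pmf.expectation (p \<bind> f) h = measure_pmf.expectation p (\<lambda>x. measure_pmf.expectation (f x) h)"
  using assms by (simp add: pmf_expectation_bind[OF assms order_refl] integral_measure_pmf[OF assms(1)])

lemma finite_set_replicate_pmf: "finite (set_pmf P) \<Longrightarrow> finite (set_pmf (replicate_pmf t P))"
  using finite_lists_length_eq[of "set_pmf P" t] by (simp add: set_replicate_pmf lists_eq_set)

lemma expectation_replicate_Suc:
  fixes f :: "'z list \<Rightarrow> real"
  assumes fin: "finite (set_pmf P)"
  shows "measure_pmf.expectation (replicate_pmf (Suc t) P) f
    = measure_pmf.expectation (replicate_pmf t P) (\<lambda>h. measure_pmf.expectation P (\<lambda>z. f (z # h)))"
proof -
  have "replicate_pmf (Suc t) P = replicate_pmf t P \<bind> (\<lambda>h. map_pmf (\<lambda>z. z # h) P)"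
    by (simp add: map_pmf_def bind_commute_pmf[of P])
  then show ?thesis
    using fin by (simp only: expectation_bind_finite finite_set_replicate_pmf set_map_pmf finite_imageI integral_map_pmf)
qed

text \<open>
  Projected stochastic gradient descent along a list of samples. The most recent sample is the head, so that
  the sample at time \<open>length h\<close> extends the past \<open>h\<close> by one constructor.
\<close>

primrec sgd :: "'a::euclidean_space set \<Rightarrow> ('z \<Rightarrow> 'a \<Rightarrow> 'a) \<Rightarrow> (nat \<Rightarrow> real) \<Rightarrow> 'a \<Rightarrow> 'z list \<Rightarrow> 'a"
  where
    "sgd W g \<alpha> x0 [] = x0"
  | "sgd W g \<alpha> x0 (z # h) =
      closest_point W (sgd W g \<alpha> x0 h - \<alpha> (length h) *\<^sub>R g z (sgd W g \<alpha> x0 h))"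

locale projected_sgd =
  fixes W :: "'a::euclidean_space set" and P :: "'z pmf" and g :: "'z \<Rightarrow> 'a \<Rightarrow> 'a"
    and \<alpha> :: "nat \<Rightarrow> real" and x0 :: 'a and grad :: "'a \<Rightarrow> 'a"
  assumes closed: "closed W" and convex: "convex W" and nonempty: "W \<noteq> {}"
    and finite_support: "finite (set_pmf P)"
    and unbiased: "\<And>x. measure_pmf.expectation P (\<lambda>z. g z x) = grad x"
begin

abbreviation iterate :: "'z list \<Rightarrow> 'a" where "iterate \<equiv> sgd W g \<alpha> x0"

abbreviation E :: "nat \<Rightarrow> ('z list \<Rightarrow> real) \<Rightarrow> real"
  where "E t \<equiv> measure_pmf.expectation (replicate_pmf t P)"

abbreviation V :: "'a \<Rightarrow> real"
  where "V x \<equiv> measure_pmf.expectation P (\<lambda>z. (norm (g z x))\<^sup>2)"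

lemma integrable_P: "integrable (measure_pmf P) f"
  for f :: "'z \<Rightarrow> 'b::{banach, second_countable_topology}"
  by (rule integrable_measure_pmf_finite[OF finite_support])

lemma integrable_history: "integrable (measure_pmf (replicate_pmf t P)) f"
  for f :: "'z list \<Rightarrow> 'b::{banach, second_countable_topology}"
  by (intro integrable_measure_pmf_finite finite_set_replicate_pmf finite_support)

lemma E_mono: "(\<And>h. length h = t \<Longrightarrow> f h \<le> f' h) \<Longrightarrow> E t f \<le> E t f'"
  by (intro integral_mono_AE integrable_history) (simp add: AE_measure_pmf_iff set_replicate_pmf)

lemma E_cong: "(\<And>h. length h = t \<Longrightarrow> f h = f' h) \<Longrightarrow> E t f = E t f'"
  by (intro integral_cong_AE) (simp_all add: AE_measure_pmf_iff set_replicate_pmf)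

lemma sgd_in: "h \<noteq> [] \<Longrightarrow> iterate h \<in> W"
  using closest_point_in_set[OF closed nonempty] by (cases h) auto

lemma V_nonneg: "0 \<le> V x"
  by simp

text \<open>
  The comparison point \<open>y h\<close> may depend on the past. Averaging over the new sample alone turns the
  stochastic gradient into the gradient because \<open>y h\<close> is fixed at that stage.
\<close>

lemma expected_step:
  assumes "\<And>h. length h = t \<Longrightarrow> y h \<in> W"
  shows "E (Suc t) (\<lambda>h. (norm (iterate h - y (tl h)))\<^sup>2)
    \<le> E t (\<lambda>h. (norm (iterate h - y h))\<^sup>2) - 2 * \<alpha> t * E t (\<lambda>h. inner (grad (iterate h)) (iterate h - y h))
      + (\<alpha> t)\<^sup>2 * E t (\<lambda>h. V (iterate h))"
proof -
  have "E (Suc t) (\<lambda>h. (norm (iterate h - y (tl h)))\<^sup>2)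
     = E t (\<lambda>h. measure_pmf.expectation P (\<lambda>z. (norm (iterate (z # h) - y h))\<^sup>2))"
    by (simp only: expectation_replicate_Suc[OF finite_support] list.sel)
  also have "\<dots> \<le> E t (\<lambda>h. (norm (iterate h - y h))\<^sup>2 - 2 * \<alpha> t * inner (grad (iterate h)) (iterate h - y h) + (\<alpha> t)\<^sup>2 * V (iterate h))"
  proof (rule E_mono)
    fix h :: "'z list" assume h: "length h = t"
    have "measure_pmf.expectation P (\<lambda>z. (norm (iterate (z # h) - y h))\<^sup>2)
      \<le> measure_pmf.expectation P (\<lambda>z. (norm (iterate h - y h))\<^sup>2 - 2 * \<alpha> t * inner (g z (iterate h)) (iterate h - y h)
            + (\<alpha> t)\<^sup>2 * (norm (g z (iterate h)))\<^sup>2)"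
      using norm_projected_step_sq[OF closed convex assms[OF h]] h
      by (intro integral_mono integrable_P) simp
    also have "\<dots> = (norm (iterate h - y h))\<^sup>2 - 2 * \<alpha> t * inner (grad (iterate h)) (iterate h - y h) + (\<alpha> t)\<^sup>2 * V (iterate h)"
      by (simp add: integrable_P unbiased[symmetric])
    finally show "measure_pmf.expectation P (\<lambda>z. (norm (iterate (z # h) - y h))\<^sup>2) \<le> \<dots>" .
  qed
  also have "\<dots> = E t (\<lambda>h. (norm (iterate h - y h))\<^sup>2) - 2 * \<alpha> t * E t (\<lambda>h. inner (grad (iterate h)) (iterate h - y h))
      + (\<alpha> t)\<^sup>2 * E t (\<lambda>h. V (iterate h))"
    by (simp add: integrable_history)
  finally show ?thesis .
qed

text \<open>
  The marginal law of the oldest \<open>s\<close> samples; it expresses expectations of an earlier iterate on the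
  longer list.
\<close>

lemma E_drop: "s \<le> t \<Longrightarrow> E t (\<lambda>h. f (drop (length h - s) h)) = E s f"
proof (induction t rule: dec_induct)
  case base
  show ?case by (intro E_cong) simp
next
  case (step t)
  have "E (Suc t) (\<lambda>h. f (drop (length h - s) h)) = E t (\<lambda>h. measure_pmf.expectation P (\<lambda>z. f (drop (Suc (length h) - s) (z # h))))"
    by (simp only: expectation_replicate_Suc[OF finite_support] list.size add_Suc_right add_0_right)
  also have "\<dots> = E t (\<lambda>h. f (drop (length h - s) h))"
    using step(1) by (intro E_cong) (simp add: Suc_diff_le)
  finally show ?case using step by simp
qed

lemma last_iterate_bound:
  assumes C: "C > 0" and steps: "\<And>t. t \<ge> 1 \<Longrightarrow> \<alpha> t = C / sqrt (real t)"
    and convex_F: "\<And>x y. F x + inner (grad x) (y - x) \<le> F y"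
    and K: "\<And>x y. x \<in> W \<Longrightarrow> y \<in> W \<Longrightarrow> norm (x - y) \<le> K"
    and G: "\<And>x. x \<in> W \<Longrightarrow> V x \<le> G"
    and xs: "xs \<in> W" and t: "t \<ge> 1"
  shows "E t (\<lambda>h. F (iterate h)) - F xs \<le> (K\<^sup>2 / C + C * G) * ((2 + ln (real t)) / sqrt (real t))"
proof -
  define f where "f t = E t (\<lambda>h. F (iterate h)) - F xs" for t
  \<comment> \<open>The iterate at time \<open>s\<close>, read off the oldest \<open>s\<close> samples of the history \<open>h\<close>.\<close>
  define past where "past s h = iterate (drop (length h - s) h)" for s h
  define e where "e t = E t (\<lambda>h. (norm (iterate h - xs))\<^sup>2)" for t
  define d where "d s t = E t (\<lambda>h. (norm (iterate h - past s h))\<^sup>2)" for s t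
  have inW: "iterate h \<in> W" if "length h = u" "u \<ge> 1" for h u
    using that by (intro sgd_in) auto
  have pastW: "past s h \<in> W" if "length h = u" "1 \<le> s" "s \<le> u" for s u h
    unfolding past_def by (rule inW[where u = s]) (use that in auto)
  have sq: "(norm (x - y))\<^sup>2 \<le> K\<^sup>2" if "x \<in> W" "y \<in> W" for x y
    using K[OF that] by (simp add: power_mono)
  have step: "E (Suc u) (\<lambda>h. (norm (iterate h - y (tl h)))\<^sup>2)
      \<le> E u (\<lambda>h. (norm (iterate h - y h))\<^sup>2) - 2 * \<alpha> u * (E u (\<lambda>h. F (iterate h)) - E u (\<lambda>h. F (y h))) + (\<alpha> u)\<^sup>2 * G"
    if u: "u \<ge> 1" and y: "\<And>h. length h = u \<Longrightarrow> y h \<in> W" for u y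
  proof -
    have \<alpha>: "\<alpha> u > 0" using u steps[of u] C by simp
    have "E u (\<lambda>h. F (iterate h)) - E u (\<lambda>h. F (y h)) = E u (\<lambda>h. F (iterate h) - F (y h))"
      by (simp add: integrable_history)
    also have "\<dots> \<le> E u (\<lambda>h. inner (grad (iterate h)) (iterate h - y h))"
    proof (rule E_mono)
      fix h :: "'z list"
      show "F (iterate h) - F (y h) \<le> inner (grad (iterate h)) (iterate h - y h)"
        using convex_F[of "iterate h" "y h"] by (simp add: inner_diff_right)
    qed
    finally have "2 * \<alpha> u * (E u (\<lambda>h. F (iterate h)) - E u (\<lambda>h. F (y h))) \<le> 2 * \<alpha> u * \<dots>"
      using \<alpha> by (intro mult_left_mono) auto
    moreover have "E u (\<lambda>h. V (iterate h)) \<le> E u (\<lambda>_. G)"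
      by (intro E_mono G inW) (use u in auto)
    then have "(\<alpha> u)\<^sup>2 * E u (\<lambda>h. V (iterate h)) \<le> (\<alpha> u)\<^sup>2 * G"
      by (intro mult_left_mono) auto
    ultimately show ?thesis
      using expected_step[of u y, OF y] by linarith
  qed
  have "f t \<le> (K\<^sup>2 / C + C * G) * ((2 + ln (real t)) / sqrt (real t))"
  proof (rule last_iterate_rate[where a = \<alpha> and e = e and d = d])
    show "0 \<le> G" using G[OF xs] V_nonneg[of xs] by linarith
    show "0 \<le> e u" for u by (simp add: e_def)
    show "e u \<le> K\<^sup>2" if "u \<ge> 1" for u
    proof -
      have "e u \<le> E u (\<lambda>_. K\<^sup>2)" unfolding e_def by (intro E_mono sq inW[where u = u] xs) (use that in auto)
      then show ?thesis by simp
    qed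
    show "e (Suc u) \<le> e u - 2 * \<alpha> u * f u + (\<alpha> u)\<^sup>2 * G" if "u \<ge> 1" for u
      using step[OF that, of "\<lambda>_. xs"] xs by (simp add: e_def f_def)
    show "0 \<le> d s u" for s u by (simp add: d_def)
    show "d s u \<le> K\<^sup>2" if "1 \<le> s" "s \<le> u" for s u
    proof -
      have "d s u \<le> E u (\<lambda>_. K\<^sup>2)" unfolding d_def by (intro E_mono sq inW[where u = u] pastW[where u = u]) (use that in auto)
      then show ?thesis by simp
    qed
    show "d s s = 0" for s
    proof -
      have "d s s = E s (\<lambda>_. 0)" unfolding d_def past_def by (rule E_cong) simp
      then show ?thesis by simp
    qed
    show "d s (Suc u) \<le> d s u - 2 * \<alpha> u * (f u - f s) + (\<alpha> u)\<^sup>2 * G" if "1 \<le> s" "s \<le> u" for s u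
    proof -
      have "d s (Suc u) = E (Suc u) (\<lambda>h. (norm (iterate h - past s (tl h)))\<^sup>2)"
        unfolding d_def
      proof (rule E_cong)
        fix h :: "'z list" assume "length h = Suc u"
        then obtain z h' where "h = z # h'" "length h' = u" by (cases h) auto
        then show "(norm (iterate h - past s h))\<^sup>2 = (norm (iterate h - past s (tl h)))\<^sup>2"
          using that by (simp add: past_def Suc_diff_le)
      qed
      moreover have "E u (\<lambda>h. F (past s h)) = E s (\<lambda>h. F (iterate h))"
        unfolding past_def using E_drop[OF that(2), of "\<lambda>h. F (iterate h)"] .
      ultimately show ?thesis
        using step[of u "past s"] pastW that by (simp add: d_def f_def)
    qed
  qed (use C steps t in auto)
  then show ?thesis by (simp add: f_def)
qed

lemma strongly_monotone_step:
  assumes "\<And>x. \<mu> * (norm (x - xs))\<^sup>2 \<le> inner (grad x) (x - xs)" "xs \<in> W" "\<alpha> t \<ge> 0"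
  shows "E (Suc t) (\<lambda>h. (norm (iterate h - xs))\<^sup>2)
    \<le> (1 - 2 * \<alpha> t * \<mu>) * E t (\<lambda>h. (norm (iterate h - xs))\<^sup>2) + (\<alpha> t)\<^sup>2 * E t (\<lambda>h. V (iterate h))"
proof -
  have "E t (\<lambda>h. \<mu> * (norm (iterate h - xs))\<^sup>2) \<le> E t (\<lambda>h. inner (grad (iterate h)) (iterate h - xs))"
    by (intro E_mono assms)
  then have "2 * \<alpha> t * (\<mu> * E t (\<lambda>h. (norm (iterate h - xs))\<^sup>2)) \<le> 2 * \<alpha> t * E t (\<lambda>h. inner (grad (iterate h)) (iterate h - xs))"
    using assms(3) by (intro mult_left_mono) auto
  then show ?thesis
    using expected_step[of t "\<lambda>_. xs"] assms(2) by (simp add: algebra_simps)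
qed

end

section \<open>Expectation over random histories\<close>

lemma pmf_replicate_Cons:
  "pmf (replicate_pmf (Suc t) P) (z # h) = pmf P z * pmf (replicate_pmf t P) h"
proof -
  have "replicate_pmf (Suc t) P = map_pmf (\<lambda>(z, h). z # h) (pair_pmf P (replicate_pmf t P))"
    by (simp add: pair_pmf_def map_bind_pmf)
  moreover have "inj (\<lambda>(z, h). z # h)" by (auto simp: inj_def)
  ultimately show ?thesis
    using pmf_map_inj'[of "\<lambda>(z, h). z # h" "pair_pmf P (replicate_pmf t P)" "(z, h)"]
    by (simp add: pmf_pair)
qed

text \<open>Newest sample first, matching the argument order of \<open>sgd\<close>.\<close>

definition history :: "(nat \<Rightarrow> 'w \<Rightarrow> 'z) \<Rightarrow> nat \<Rightarrow> 'w \<Rightarrow> 'z list"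
  where "history Z t \<omega> = map (\<lambda>s. Z s \<omega>) (rev [0..<t])"

lemma history_0 [simp]: "history Z 0 \<omega> = []"
  and history_Suc [simp]: "history Z (Suc t) \<omega> = Z t \<omega> # history Z t \<omega>"
  and length_history [simp]: "length (history Z t \<omega>) = t"
  by (simp_all add: history_def)

lemma history_eq_iff:
  "length h = t \<Longrightarrow> history Z t \<omega> = h \<longleftrightarrow> (\<forall>s<t. Z s \<omega> = rev h ! s)"
proof -
  assume l: "length h = t"
  have "history Z t \<omega> = h \<longleftrightarrow> map (\<lambda>s. Z s \<omega>) [0..<t] = rev h"
    by (metis history_def rev_map rev_rev_ident)
  also have "\<dots> \<longleftrightarrow> (\<forall>s<t. Z s \<omega> = rev h ! s)"
    using l by (auto simp: list_eq_iff_nth_eq)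
  finally show ?thesis .
qed

context prob_space
begin

text \<open>
  The conditional law of the next sample does not depend on the past, so the probability of a history is
  a product. A history of probability zero stays so after one more sample, on both sides.
\<close>

lemma prob_history:
  assumes meas: "\<And>t z. {\<omega>\<in>space M. Z t \<omega> = z} \<in> events"
    and cond: "\<And>t z h. \<P>(\<omega> in M. \<forall>s<t. Z s \<omega> = h s) > 0 \<Longrightarrow>
        \<P>(\<omega> in M. Z t \<omega> = z \<bar> \<forall>s<t. Z s \<omega> = h s) = pmf P z"
  shows "{\<omega>\<in>space M. history Z t \<omega> = h} \<in> events" (is "?meas t h")
    and "\<P>(\<omega> in M. history Z t \<omega> = h) = pmf (replicate_pmf t P) h" (is "?prob t h")
proof -
  have "?meas t h \<and> ?prob t h"
  proof (induction t arbitrary: h)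
    case 0
    show ?case by (cases "h = []") (simp_all add: prob_space)
  next
    case (Suc t)
    show ?case
    proof (cases h)
      case Nil
      then show ?thesis by (auto simp: pmf_eq_0_set_pmf set_replicate_pmf)
    next
      case (Cons z h')
      let ?S = "{\<omega>\<in>space M. history Z t \<omega> = h'}"
      have split: "{\<omega>\<in>space M. history Z (Suc t) \<omega> = h} = {\<omega>\<in>space M. Z t \<omega> = z} \<inter> ?S"
        using Cons by auto
      have S: "?S \<in> events" "prob ?S = pmf (replicate_pmf t P) h'"
        using Suc[of h'] by auto
      have "prob ({\<omega>\<in>space M. Z t \<omega> = z} \<inter> ?S) = pmf P z * pmf (replicate_pmf t P) h'"
      proof (cases "prob ?S = 0")
        case True
        have "prob ({\<omega>\<in>space M. Z t \<omega> = z} \<inter> ?S) \<le> prob ?S"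
          using S(1) by (intro finite_measure_mono) auto
        then show ?thesis using True S(2) by (simp add: measure_le_0_iff)
      next
        case False
        then have l: "length h' = t"
          using S(2) by (simp add: pmf_eq_0_set_pmf set_replicate_pmf)
        have pos: "\<P>(\<omega> in M. \<forall>s<t. Z s \<omega> = rev h' ! s) > 0"
          using False history_eq_iff[OF l, of Z] by (simp add: zero_less_measure_iff)
        have "\<P>(\<omega> in M. Z t \<omega> = z \<bar> history Z t \<omega> = h') = pmf P z"
          using cond[OF pos, of z] by (simp add: history_eq_iff[OF l])
        then have "prob {\<omega>\<in>space M. Z t \<omega> = z \<and> history Z t \<omega> = h'} = pmf P z * prob ?S"
          using False by (simp add: cond_prob_def field_simps)
        moreover have "{\<omega>\<in>space M. Z t \<omega> = z \<and> history Z t \<omega> = h'} = {\<omega>\<in>space M. Z t \<omega> = z} \<inter> ?S"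
          by auto
        ultimately show ?thesis using S(2) by simp
      qed
      then show ?thesis
        unfolding split using S(1) meas[of t z] Cons by (auto simp: pmf_replicate_Cons simp del: replicate_pmf.simps)
    qed
  qed
  then show "?meas t h" "?prob t h" by auto
qed

text \<open>
  The laws agree on the finitely many histories that carry all the mass. Both integrals are finite
  sums over these, and measurability of the integrand allows null sets to be ignored.
\<close>

lemma expectation_history:
  fixes f :: "'z list \<Rightarrow> real"
  assumes fin: "finite (set_pmf P)"
    and meas: "\<And>t z. {\<omega>\<in>space M. Z t \<omega> = z} \<in> events"
    and cond: "\<And>t z h. \<P>(\<omega> in M. \<forall>s<t. Z s \<omega> = h s) > 0 \<Longrightarrow>
        \<P>(\<omega> in M. Z t \<omega> = z \<bar> \<forall>s<t. Z s \<omega> = h s) = pmf P z"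
    and f: "(\<lambda>\<omega>. f (history Z t \<omega>)) \<in> borel_measurable M"
  shows "expectation (\<lambda>\<omega>. f (history Z t \<omega>)) = measure_pmf.expectation (replicate_pmf t P) f"
proof -
  note ph = prob_history[where Z = Z and P = P, OF meas cond]
  define S where "S = set_pmf (replicate_pmf t P)"
  have S: "finite S" unfolding S_def by (rule finite_set_replicate_pmf[OF fin])
  define H where "H h = {\<omega>\<in>space M. history Z t \<omega> = h}" for h
  have H: "H h \<in> events" "prob (H h) = pmf (replicate_pmf t P) h" for h
    using ph[where t = t and h = h] by (simp_all add: H_def)
  have "prob (\<Union>h\<in>S. H h) = (\<Sum>h\<in>S. prob (H h))"
    by (intro finite_measure_finite_Union S) (auto simp: disjoint_family_on_def H_def H(1)[unfolded H_def])
  also have "\<dots> = 1"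
    unfolding H(2) S_def by (intro sum_pmf_eq_1 order_refl finite_set_replicate_pmf[OF fin])
  finally have "AE \<omega> in M. \<omega> \<in> (\<Union>h\<in>S. H h)"
    by (rule AE_prob_1)
  then have "AE \<omega> in M. f (history Z t \<omega>) = (\<Sum>h\<in>S. f h * indicator (H h) \<omega>)"
  proof (rule AE_mp, intro AE_I2 impI)
    fix \<omega> assume \<omega>: "\<omega> \<in> space M" and "\<omega> \<in> (\<Union>h\<in>S. H h)"
    then have "history Z t \<omega> \<in> S" by (auto simp: H_def)
    moreover have "f h * indicator (H h) \<omega> = (if h = history Z t \<omega> then f h else 0)" for h
      using \<omega> by (auto simp: H_def indicator_def)
    ultimately show "f (history Z t \<omega>) = (\<Sum>h\<in>S. f h * indicator (H h) \<omega>)"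
      using S by simp
  qed
  then have "expectation (\<lambda>\<omega>. f (history Z t \<omega>)) = expectation (\<lambda>\<omega>. \<Sum>h\<in>S. f h * indicator (H h) \<omega>)"
    using f H(1) by (intro integral_cong_AE) auto
  also have "\<dots> = (\<Sum>h\<in>S. f h * prob (H h))"
    using H(1) by (subst Bochner_Integration.integral_sum) (auto simp: emeasure_eq_measure)
  also have "\<dots> = measure_pmf.expectation (replicate_pmf t P) f"
    unfolding H(2) using S by (subst integral_measure_pmf_real[of S]) (auto simp: S_def)
  finally show ?thesis .
qed

end

section \<open>The random iterates of the algorithm\<close>

text \<open>
  The law of one sample: a uniform row index together with the mask on that row, the part of the mask
  that the update reads.
\<close>

definition row_mask_law :: "('m::finite, 'l::finite, 'n::finite) tensor pmf \<Rightarrow> ('m \<times> (1, 'l, 'n) tensor) pmf"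
  where "row_mask_law Q = pmf_of_set UNIV \<bind> (\<lambda>i. map_pmf (\<lambda>D. (i, row_slice D i)) Q)"

lemma pmf_row_mask_law:
  fixes Q :: "('m::finite, 'l::finite, 'n::finite) tensor pmf"
  shows "pmf (row_mask_law Q) (i, d) = 1 / real CARD('m) * pmf (map_pmf (\<lambda>D. row_slice D i) Q) d"
proof -
  have "pmf (map_pmf (\<lambda>D. (j, row_slice D j)) Q) (i, d)
      = (if j = i then pmf (map_pmf (\<lambda>D. row_slice D i) Q) d else 0)" for j
  proof (cases "j = i")
    case True
    have "map_pmf (\<lambda>D. (i, row_slice D i)) Q = map_pmf (Pair i) (map_pmf (\<lambda>D. row_slice D i) Q)"
      by (simp add: pmf.map_comp comp_def)
    then show ?thesis using True by (simp add: pmf_map_inj' inj_def)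
  next
    case False
    then show ?thesis by (auto simp: pmf_eq_0_set_pmf)
  qed
  then show ?thesis
    by (simp add: row_mask_law_def pmf_bind integral_pmf_of_set)
qed

lemma finite_row_mask_law: "finite (set_pmf Q) \<Longrightarrow> finite (set_pmf (row_mask_law Q))"
  by (simp add: row_mask_law_def)

lemma expectation_row_mask_law:
  fixes Q :: "('m::finite, 'l::finite, 'n::finite) tensor pmf"
    and f :: "'m \<times> (1, 'l, 'n) tensor \<Rightarrow> 'x::{banach, second_countable_topology}"
  assumes "finite (set_pmf Q)"
  shows "measure_pmf.expectation (row_mask_law Q) f
    = (1 / real CARD('m)) *\<^sub>R (\<Sum>i\<in>UNIV. measure_pmf.expectation Q (\<lambda>D. f (i, row_slice D i)))"
  unfolding row_mask_law_def using assms
  by (subst pmf_expectation_bind_pmf_of_set) (auto simp: scaleR_sum_right inverse_eq_divide)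

text \<open>
  The update as a function of such a sample. The single mask row is copied to all rows to form an argument
  of the required size; the update reads only the selected one.
\<close>

definition row_grad :: "real \<Rightarrow> ('l::finite, 'l, 'n::finite) tensor \<Rightarrow> ('m::finite, 'l, 'n) tensor
    \<Rightarrow> ('m, 'q::finite, 'n) tensor \<Rightarrow> 'm \<times> (1, 'l, 'n) tensor \<Rightarrow> ('l, 'q, 'n) tensor \<Rightarrow> ('l, 'q, 'n) tensor"
  where "row_grad p C A B z = grad_update p C A B (fst z) (\<chi> _. snd z $ 1)"

lemma row_grad_row_slice: "row_grad p C A B (i, row_slice D i) X = grad_update p C A B i D X"
proof -
  have "row_slice (hadamard (\<chi> _. row_slice D i $ 1) A) i = row_slice (hadamard D A) i"
    by (simp add: vec_eq_iff)
  then show ?thesis by (simp add: row_grad_def grad_update_def)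
qed

lemma msgdt_eq_sgd:
  "msgdt p C A B W X0 \<alpha> (\<lambda>s. I s \<omega>) (\<lambda>s. D s \<omega>) t
    = sgd W (row_grad p C A B) \<alpha> X0 (history (\<lambda>s \<omega>. (I s \<omega>, row_slice (D s \<omega>) (I s \<omega>))) t \<omega>)"
  by (induction t) (simp_all add: Let_def row_grad_row_slice)

lemma continuous_on_grad_update:
  fixes A :: "('m::finite, 'l::finite, 'n::finite) tensor" and B :: "('m, 'q::finite, 'n) tensor"
  shows "continuous_on UNIV (\<lambda>z. grad_update p C A B i (fst z) (snd z))"
  unfolding grad_update_def Let_def tprod_def ttranspose_def hadamard_def frontal_def row_slice_def
    matrix_matrix_mult_def transpose_def
  by (simp only: vec_lambda_beta) (intro continuous_intros)

text \<open>
  The update is continuous in mask and iterate for each of the finitely many rows, and the projection is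
  continuous.
\<close>

lemma measurable_msgdt:
  fixes A :: "('m::finite, 'l::finite, 'n::finite) tensor" and B :: "('m, 'q::finite, 'n) tensor"
    and D :: "nat \<Rightarrow> 'w \<Rightarrow> ('m, 'l, 'n) tensor"
  assumes W: "closed W" "convex W" "W \<noteq> {}"
    and I: "\<And>t. I t \<in> measurable M (count_space UNIV)" and D: "\<And>t. D t \<in> borel_measurable M"
  shows "(\<lambda>\<omega>. msgdt p C A B W X0 \<alpha> (\<lambda>s. I s \<omega>) (\<lambda>s. D s \<omega>) t) \<in> borel_measurable M"
proof (induction t)
  case (Suc t)
  define X where "X \<omega> = msgdt p C A B W X0 \<alpha> (\<lambda>s. I s \<omega>) (\<lambda>s. D s \<omega>) t" for \<omega>
  have X: "X \<in> borel_measurable M" unfolding X_def by (rule Suc)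
  have P: "closest_point W \<in> borel_measurable borel"
    using W by (intro borel_measurable_continuous_onI continuous_on_closest_point) auto
  have g: "(\<lambda>\<omega>. grad_update p C A B i (D t \<omega>) (X \<omega>)) \<in> borel_measurable M" for i
    using measurable_compose[OF borel_measurable_Pair[OF D X]
        borel_measurable_continuous_onI[OF continuous_on_grad_update]] by simp
  have "(\<lambda>\<omega>. grad_update p C A B (I t \<omega>) (D t \<omega>) (X \<omega>)) \<in> borel_measurable M"
    by (rule measurable_compose_countable'[OF g I]) (simp add: countable_finite)
  then have "(\<lambda>\<omega>. X \<omega> - \<alpha> t *\<^sub>R grad_update p C A B (I t \<omega>) (D t \<omega>) (X \<omega>)) \<in> borel_measurable M"
    using X by simp
  from measurable_compose[OF this P] show ?case
    by (simp add: Let_def X_def)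
qed simp

lemma continuous_on_loss: "continuous_on UNIV (loss A B)"
  unfolding loss_def tprod_def frontal_def matrix_matrix_mult_def
  by (simp only: vec_lambda_beta) (intro continuous_intros)

lemma row_assumption_law:
  fixes I :: "nat \<Rightarrow> 'w \<Rightarrow> 'm::finite" and D :: "nat \<Rightarrow> 'w \<Rightarrow> ('m, 'l::finite, 'n::finite) tensor"
  assumes rows: "row_assumption M I D Q"
  defines "Z \<equiv> \<lambda>s \<omega>. (I s \<omega>, row_slice (D s \<omega>) (I s \<omega>))"
  shows "{\<omega>\<in>space M. Z t \<omega> = z} \<in> sets M"
    and "measure M {\<omega>\<in>space M. \<forall>s<t. Z s \<omega> = h s} > 0 \<Longrightarrow>
        cond_prob M (\<lambda>\<omega>. Z t \<omega> = z) (\<lambda>\<omega>. \<forall>s<t. Z s \<omega> = h s) = pmf (row_mask_law Q) z"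
proof -
  obtain i d where z: "z = (i, d)" by (cases z)
  have I: "I t \<in> measurable M (count_space UNIV)" and D: "D t \<in> borel_measurable M"
    using rows by (auto simp: row_assumption_def)
  have "continuous_on UNIV (\<lambda>T :: ('m, 'l, 'n) tensor. row_slice T i)"
    unfolding row_slice_def by (intro continuous_intros)
  then have "(\<lambda>\<omega>. row_slice (D t \<omega>) i) \<in> borel_measurable M"
    by (intro measurable_compose[OF D] borel_measurable_continuous_onI)
  then have "{\<omega>\<in>space M. row_slice (D t \<omega>) i = d} \<in> sets M"
    by measurable
  moreover have "{\<omega>\<in>space M. I t \<omega> = i} \<in> sets M"
    using I by measurable
  moreover have "{\<omega>\<in>space M. Z t \<omega> = z} = {\<omega>\<in>space M. I t \<omega> = i} \<inter> {\<omega>\<in>space M. row_slice (D t \<omega>) i = d}"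
    by (auto simp: z Z_def)
  ultimately show "{\<omega>\<in>space M. Z t \<omega> = z} \<in> sets M" by auto
  assume "measure M {\<omega>\<in>space M. \<forall>s<t. Z s \<omega> = h s} > 0"
  then show "cond_prob M (\<lambda>\<omega>. Z t \<omega> = z) (\<lambda>\<omega>. \<forall>s<t. Z s \<omega> = h s) = pmf (row_mask_law Q) z"
    using rows unfolding z pmf_row_mask_law by (simp add: row_assumption_def Z_def)
qed

lemma expectation_msgdt:
  fixes A :: "('m::finite, 'l::finite, 'n::finite) tensor" and B :: "('m, 'q::finite, 'n) tensor"
    and D :: "nat \<Rightarrow> 'w \<Rightarrow> ('m, 'l, 'n) tensor" and f :: "('l, 'q, 'n) tensor \<Rightarrow> real"
  assumes M: "prob_space M" and rows: "row_assumption M I D Q" and Q: "finite (set_pmf Q)"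
    and W: "closed W" "convex W" "W \<noteq> {}" and f: "continuous_on UNIV f"
  shows "prob_space.expectation M (\<lambda>\<omega>. f (msgdt p C A B W X0 \<alpha> (\<lambda>s. I s \<omega>) (\<lambda>s. D s \<omega>) t))
    = measure_pmf.expectation (replicate_pmf t (row_mask_law Q)) (\<lambda>h. f (sgd W (row_grad p C A B) \<alpha> X0 h))"
proof -
  have ID: "I t \<in> measurable M (count_space UNIV)" "D t \<in> borel_measurable M" for t
    using rows by (auto simp: row_assumption_def)
  have "(\<lambda>\<omega>. f (msgdt p C A B W X0 \<alpha> (\<lambda>s. I s \<omega>) (\<lambda>s. D s \<omega>) t)) \<in> borel_measurable M"
    by (intro measurable_compose[OF measurable_msgdt] borel_measurable_continuous_onI W ID f)
  then show ?thesis
    unfolding msgdt_eq_sgd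
    by (intro prob_space.expectation_history[OF M] finite_row_mask_law Q row_assumption_law[OF rows])
qed

section \<open>The loss and the second moment of its gradient estimates\<close>

definition loss_grad :: "('m::finite, 'l::finite, 'n::finite) tensor \<Rightarrow> ('m, 'q::finite, 'n) tensor
    \<Rightarrow> ('l, 'q, 'n) tensor \<Rightarrow> ('l, 'q, 'n) tensor"
  where "loss_grad A B X = (1 / real CARD('m)) *\<^sub>R
    (\<Sum>i\<in>UNIV. ttranspose (row_slice A i) \<star> (row_slice A i \<star> X - row_slice B i))"

lemma inner_loss_grad:
  fixes A :: "('m::finite, 'l::finite, 'n::finite) tensor"
  shows "inner (loss_grad A B X) V = inner (A \<star> X - B) (A \<star> V) / real CARD('m)"
  by (simp add: loss_grad_def inner_sum_left inner_ttranspose_tprod sum_inner_row_slice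
      flip: row_slice_tprod row_slice_diff)

text \<open>The exact second-order expansion of a quadratic; its remainder is nonnegative, which gives convexity.\<close>

lemma loss_expansion:
  fixes A :: "('m::finite, 'l::finite, 'n::finite) tensor"
  shows "loss A B Y = loss A B X + inner (loss_grad A B X) (Y - X)
    + (norm (A \<star> (Y - X)))\<^sup>2 / (2 * real CARD('m))"
proof -
  have "A \<star> Y - B = (A \<star> X - B) + A \<star> (Y - X)"
    by (simp add: tprod_diff_right)
  then have "(norm (A \<star> Y - B))\<^sup>2 = (norm (A \<star> X - B))\<^sup>2 + 2 * inner (A \<star> X - B) (A \<star> (Y - X)) + (norm (A \<star> (Y - X)))\<^sup>2"
    by (simp only: power2_norm_eq_inner inner_add_left inner_add_right inner_commute[of "A \<star> (Y - X)" "A \<star> X - B"])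
  then show ?thesis
    by (simp add: loss_def inner_loss_grad add_divide_distrib)
qed

lemma projected_sgd_msgdt:
  fixes A :: "('m::finite, 'l::finite, 'n::finite) tensor" and B :: "('m, 'q::finite, 'n) tensor"
    and Q :: "('m, 'l, 'n) tensor pmf"
  assumes p: "0 < p" "p < 1" and mask: "mask_moments p C Q" and W: "closed W" "convex W" "W \<noteq> {}"
  shows "projected_sgd W (row_mask_law Q) (row_grad p C A B) (loss_grad A B)"
  using W finite_row_mask_law[OF mask_moments_finite[OF mask]]
  by unfold_locales (simp_all add: expectation_row_mask_law mask_moments_finite[OF mask]
      row_grad_row_slice expectation_grad_update[OF p mask] loss_grad_def)

lemma second_moment_row_grad:
  fixes A :: "('m::finite, 'l::finite, 'n::finite) tensor" and B :: "('m, 'q::finite, 'n) tensor"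
    and Q :: "('m, 'l, 'n) tensor pmf"
  assumes p: "0 < p" "p < 1" and mask: "mask_moments p C Q"
  shows "measure_pmf.expectation (row_mask_law Q) (\<lambda>z. (norm (row_grad p C A B z X))\<^sup>2)
    \<le> 1 / real CARD('m) * (\<Sum>i\<in>UNIV. p * (norm (row_slice A i))\<^sup>2
        * ((2 - p) / p\<^sup>2 * real CARD('n) * norm (row_slice A i) * norm X
            + sqrt (real CARD('n)) / p * norm (row_slice B i))\<^sup>2)"
  unfolding expectation_row_mask_law[OF mask_moments_finite[OF mask]] row_grad_row_slice real_scaleR_def
  by (intro mult_left_mono sum_mono second_moment_grad_update[OF p mask]) simp

text \<open>Expanding the square of the general bound. The two factors \<open>2 - p\<close> and \<open>p\<close> are rounded up to 2.\<close>

lemma second_moment_le_G: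
  fixes A :: "('m::finite, 'l::finite, 'n::finite) tensor" and B :: "('m, 'q::finite, 'n) tensor"
    and Q :: "('m, 'l, 'n) tensor pmf"
  assumes p: "0 < p" "p < 1" and mask: "mask_moments p C Q" and X: "norm X \<le> R"
  shows "measure_pmf.expectation (row_mask_law Q) (\<lambda>z. (norm (row_grad p C A B z X))\<^sup>2)
    \<le> 4 * real CARD('n) ^ 2 * R\<^sup>2 / (p ^ 3 * real CARD('m))
          * (\<Sum>i\<in>UNIV. norm (row_slice A i) ^ 4)
      + 4 * real CARD('n) powr (3 / 2) * R / (p\<^sup>2 * real CARD('m))
          * (\<Sum>i\<in>UNIV. norm (row_slice A i) ^ 3 * norm (row_slice B i))
      + 2 * real CARD('n) / (p\<^sup>2 * real CARD('m))
          * (\<Sum>i\<in>UNIV. norm (row_slice A i) ^ 2 * norm (row_slice B i) ^ 2)"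
proof -
  define c where "c = sqrt (real CARD('n))"
  have c: "c \<ge> 0" "real CARD('n) = c\<^sup>2" by (simp_all add: c_def)
  have R: "R \<ge> 0" using X norm_ge_zero[of X] by linarith
  have "real CARD('n) powr (3 / 2) = (real CARD('n) powr (1 / 2)) ^ 3"
    by (simp add: powr_power)
  then have c3: "real CARD('n) powr (3 / 2) = c ^ 3"
    by (simp add: powr_half_sqrt c_def)
  have term_le: "p * a\<^sup>2 * ((2 - p) / p\<^sup>2 * c\<^sup>2 * a * norm X + c / p * b)\<^sup>2
     \<le> 4 * c ^ 4 * R\<^sup>2 / p ^ 3 * a ^ 4 + 4 * c ^ 3 * R / p\<^sup>2 * (a ^ 3 * b) + 2 * c\<^sup>2 / p\<^sup>2 * (a\<^sup>2 * b\<^sup>2)"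
    if ab: "a \<ge> 0" "b \<ge> 0" for a b :: real
  proof -
    have "(2 - p) / p\<^sup>2 * c\<^sup>2 * a * norm X \<le> 2 / p\<^sup>2 * c\<^sup>2 * a * R"
      using p ab X by (intro mult_mono mult_right_mono divide_right_mono) auto
    then have "((2 - p) / p\<^sup>2 * c\<^sup>2 * a * norm X + c / p * b)\<^sup>2 \<le> (2 / p\<^sup>2 * c\<^sup>2 * a * R + c / p * b)\<^sup>2"
      using p ab c by (intro power_mono add_right_mono) auto
    then have "p * a\<^sup>2 * ((2 - p) / p\<^sup>2 * c\<^sup>2 * a * norm X + c / p * b)\<^sup>2
      \<le> p * a\<^sup>2 * (2 / p\<^sup>2 * c\<^sup>2 * a * R + c / p * b)\<^sup>2"
      using p by (intro mult_left_mono) auto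
    also have "\<dots> = 4 * c ^ 4 * R\<^sup>2 / p ^ 3 * a ^ 4 + 4 * c ^ 3 * R / p\<^sup>2 * (a ^ 3 * b) + c\<^sup>2 * p / p\<^sup>2 * (a\<^sup>2 * b\<^sup>2)"
      using p by (simp add: field_simps power2_eq_square power3_eq_cube power4_eq_xxxx)
    also have "c\<^sup>2 * p / p\<^sup>2 * (a\<^sup>2 * b\<^sup>2) \<le> 2 * c\<^sup>2 / p\<^sup>2 * (a\<^sup>2 * b\<^sup>2)"
      using p by (intro mult_right_mono divide_right_mono) (auto simp: mult.commute[of _ p] intro!: mult_right_mono)
    finally show ?thesis by simp
  qed
  have "measure_pmf.expectation (row_mask_law Q) (\<lambda>z. (norm (row_grad p C A B z X))\<^sup>2)
    \<le> 1 / real CARD('m) * (\<Sum>i\<in>UNIV. 4 * c ^ 4 * R\<^sup>2 / p ^ 3 * norm (row_slice A i) ^ 4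
      + 4 * c ^ 3 * R / p\<^sup>2 * (norm (row_slice A i) ^ 3 * norm (row_slice B i))
      + 2 * c\<^sup>2 / p\<^sup>2 * ((norm (row_slice A i))\<^sup>2 * (norm (row_slice B i))\<^sup>2))"
    by (rule order_trans[OF second_moment_row_grad[OF p mask]], unfold c_def[symmetric], unfold c(2),
        intro mult_left_mono sum_mono term_le) auto
  also have "\<dots> = 4 * real CARD('n) ^ 2 * R\<^sup>2 / (p ^ 3 * real CARD('m))
          * (\<Sum>i\<in>UNIV. norm (row_slice A i) ^ 4)
      + 4 * real CARD('n) powr (3 / 2) * R / (p\<^sup>2 * real CARD('m))
          * (\<Sum>i\<in>UNIV. norm (row_slice A i) ^ 3 * norm (row_slice B i))
      + 2 * real CARD('n) / (p\<^sup>2 * real CARD('m))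
          * (\<Sum>i\<in>UNIV. norm (row_slice A i) ^ 2 * norm (row_slice B i) ^ 2)"
    unfolding sum.distrib c3 unfolding c(2) sum_distrib_left[symmetric]
    by (simp add: distrib_left mult_ac flip: power_mult)
  finally show ?thesis .
qed

text \<open>
  Since \<open>B = A * Xs\<close>, a row of \<open>B\<close> has norm at most \<open>sqrt n * R\<close> times that of the row of \<open>A\<close>, so all terms
  have the common factor \<open>n\<^sup>2 * a ^ 4 / p ^ 3\<close>. For \<open>norm X \<le> R\<close> the weights \<open>2 - p\<close> and \<open>p\<close> sum to 2, which is the
  origin of the constant 4 in \<open>G_star\<close>.
\<close>

lemma second_moment_consistent:
  fixes A :: "('m::finite, 'l::finite, 'n::finite) tensor" and Xs :: "('l, 'q::finite, 'n) tensor"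
    and Q :: "('m, 'l, 'n) tensor pmf"
  assumes p: "0 < p" "p < 1" and mask: "mask_moments p C Q" and Xs: "norm Xs \<le> R"
  shows "measure_pmf.expectation (row_mask_law Q) (\<lambda>z. (norm (row_grad p C A (A \<star> Xs) z X))\<^sup>2)
    \<le> (real CARD('n))\<^sup>2 / real CARD('m) * (\<Sum>i\<in>UNIV. norm (row_slice A i) ^ 4) / p ^ 3
        * ((2 - p) * norm X + p * R)\<^sup>2"
proof -
  define c where "c = sqrt (real CARD('n))"
  have c: "c \<ge> 0" "real CARD('n) = c\<^sup>2" by (simp_all add: c_def)
  have term_le: "p * a\<^sup>2 * ((2 - p) / p\<^sup>2 * c\<^sup>2 * a * norm X + c / p * b)\<^sup>2
     \<le> c ^ 4 / p ^ 3 * ((2 - p) * norm X + p * R)\<^sup>2 * a ^ 4"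
    if ab: "a \<ge> 0" "b \<ge> 0" "b \<le> c * a * R" for a b :: real
  proof -
    have "c / p * b \<le> c / p * (c * a * R)"
      using p ab c by (intro mult_left_mono) auto
    then have "((2 - p) / p\<^sup>2 * c\<^sup>2 * a * norm X + c / p * b)\<^sup>2 \<le> ((2 - p) / p\<^sup>2 * c\<^sup>2 * a * norm X + c / p * (c * a * R))\<^sup>2"
      using p ab c by (intro power_mono add_left_mono) auto
    then have "p * a\<^sup>2 * ((2 - p) / p\<^sup>2 * c\<^sup>2 * a * norm X + c / p * b)\<^sup>2
      \<le> p * a\<^sup>2 * ((2 - p) / p\<^sup>2 * c\<^sup>2 * a * norm X + c / p * (c * a * R))\<^sup>2"
      using p by (intro mult_left_mono) auto
    also have "(2 - p) / p\<^sup>2 * c\<^sup>2 * a * norm X + c / p * (c * a * R) = c\<^sup>2 * a / p\<^sup>2 * ((2 - p) * norm X + p * R)"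
      using p by (simp add: field_simps power2_eq_square)
    also have "p * a\<^sup>2 * (c\<^sup>2 * a / p\<^sup>2 * ((2 - p) * norm X + p * R))\<^sup>2 = c ^ 4 / p ^ 3 * ((2 - p) * norm X + p * R)\<^sup>2 * a ^ 4"
      using p unfolding power_mult_distrib power_divide
      by (simp add: field_simps eval_nat_numeral)
    finally show ?thesis .
  qed
  have "norm (row_slice (A \<star> Xs) i) \<le> c * norm (row_slice A i) * R" for i
  proof -
    have "norm (row_slice (A \<star> Xs) i) \<le> c * norm (row_slice A i) * norm Xs"
      unfolding row_slice_tprod c_def by (rule norm_tprod_le)
    also have "\<dots> \<le> c * norm (row_slice A i) * R"
      using Xs c by (intro mult_left_mono) auto
    finally show ?thesis .
  qed
  then have "measure_pmf.expectation (row_mask_law Q) (\<lambda>z. (norm (row_grad p C A (A \<star> Xs) z X))\<^sup>2)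
    \<le> 1 / real CARD('m) * (\<Sum>i\<in>UNIV. c ^ 4 / p ^ 3 * ((2 - p) * norm X + p * R)\<^sup>2 * norm (row_slice A i) ^ 4)"
    by (intro order_trans[OF second_moment_row_grad[OF p mask]], unfold c_def[symmetric], unfold c(2),
        intro mult_left_mono sum_mono term_le) auto
  also have "\<dots> = (real CARD('n))\<^sup>2 / real CARD('m) * (\<Sum>i\<in>UNIV. norm (row_slice A i) ^ 4) / p ^ 3
        * ((2 - p) * norm X + p * R)\<^sup>2"
    unfolding c(2) sum_distrib_left[symmetric] by (simp add: mult_ac flip: power_mult)
  finally show ?thesis .
qed

text \<open>
  The loss vanishes at \<open>Xs\<close> and is quadratic along the line through \<open>Xs\<close> in direction \<open>v\<close>, so the midpoint
  inequality alone bounds the modulus.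
\<close>

lemma strongly_convex_loss_norm_le:
  fixes A :: "('m::finite, 'l::finite, 'n::finite) tensor" and Xs v :: "('l, 'q::finite, 'n) tensor"
  assumes "strongly_convex \<mu> (loss A (A \<star> Xs) :: ('l, 'q, 'n) tensor \<Rightarrow> real)"
  shows "\<mu> * (norm v)\<^sup>2 \<le> (norm (A \<star> v))\<^sup>2 / real CARD('m)"
proof -
  have loss: "loss A (A \<star> Xs) (Xs + c *\<^sub>R v) = c\<^sup>2 * (norm (A \<star> v))\<^sup>2 / (2 * real CARD('m))" for c
    by (simp add: loss_def tprod_add_right tprod_scaleR_right power_mult_distrib)
  have "(1 / 2) *\<^sub>R (Xs + v) + (1 - 1 / 2) *\<^sub>R Xs = Xs + (1 / 2) *\<^sub>R v"
    by (simp add: scaleR_add_right flip: scaleR_add_left) 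
  then have "loss A (A \<star> Xs) (Xs + (1 / 2) *\<^sub>R v)
    \<le> 1 / 2 * loss A (A \<star> Xs) (Xs + v) + (1 - 1 / 2) * loss A (A \<star> Xs) Xs
       - \<mu> / 2 * (1 / 2) * (1 - 1 / 2) * (norm (Xs + v - Xs))\<^sup>2"
    using assms[unfolded strongly_convex_def, rule_format, of "1 / 2" "Xs + v" Xs] by simp
  then show ?thesis
    using loss[of "1 / 2"] loss[of 1] loss[of 0] by (simp add: power2_eq_square field_simps)
qed

lemma strongly_convex_loss_modulus_le:
  fixes A :: "('m::finite, 'l::finite, 'n::finite) tensor" and Xs :: "('l, 'q::finite, 'n) tensor"
  assumes "strongly_convex \<mu> (loss A (A \<star> Xs) :: ('l, 'q, 'n) tensor \<Rightarrow> real)"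
  shows "\<mu> \<le> real CARD('n) / real CARD('m) * (\<Sum>i\<in>UNIV. (norm (row_slice A i))\<^sup>2)"
proof -
  \<comment> \<open>Any nonzero tensor serves; here all entries are 1.\<close>
  define v :: "('l, 'q, 'n) tensor" where "v = 1"
  have "v $ i $ j $ k = 1" for i j k by (simp add: v_def)
  then have "v \<noteq> 0" by (metis zero_index zero_neq_one)
  have "norm (A \<star> v) \<le> sqrt (real CARD('n)) * norm A * norm v" by (rule norm_tprod_le)
  then have "(norm (A \<star> v))\<^sup>2 \<le> (sqrt (real CARD('n)) * norm A * norm v)\<^sup>2"
    by (rule power_mono) simp
  also have "\<dots> = real CARD('n) * (\<Sum>i\<in>UNIV. (norm (row_slice A i))\<^sup>2) * (norm v)\<^sup>2"
    by (simp add: power_mult_distrib sum_norm_row_slice_sq)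
  finally have "\<mu> * (norm v)\<^sup>2 \<le> real CARD('n) * (\<Sum>i\<in>UNIV. (norm (row_slice A i))\<^sup>2) * (norm v)\<^sup>2 / real CARD('m)"
    using strongly_convex_loss_norm_le[OF assms, of v] by (meson divide_right_mono of_nat_0_le_iff order_trans)
  then have "\<mu> * (norm v)\<^sup>2 \<le> real CARD('n) / real CARD('m) * (\<Sum>i\<in>UNIV. (norm (row_slice A i))\<^sup>2) * (norm v)\<^sup>2"
    by simp
  then show ?thesis using \<open>v \<noteq> 0\<close> by (simp only: mult_le_cancel_right) simp
qed

section \<open>Linear convergence with a fixed step size\<close>

text \<open>
  Here \<open>s\<close> stands for \<open>\<alpha> * L_g\<close>, \<open>d\<close> for the initial distance to the minimiser and \<open>e\<close> for the mean squared
  distance after one step. The claimed additive term exceeds the noise bound \<open>\<alpha>\<^sup>2 * (N / p ^ 3 * (2 * R)\<^sup>2)\<close> by the factor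
  \<open>1 / (\<alpha> * \<mu> * (1 - s))\<close>, which is at least \<open>1 / (p\<^sup>2 * s * (1 - s))\<close>. It therefore covers the noise at distance \<open>d\<close>
  when \<open>s * (1 - s) * (2 * R + d)\<^sup>2 \<le> 4 * R\<^sup>2\<close>. Otherwise \<open>d > 2 * R\<close>, and the bound \<open>4 * R\<^sup>2\<close> on \<open>e\<close> suffices.
\<close>

lemma first_step_bound:
  fixes p s \<alpha> \<mu> N R d e :: real
  assumes p: "0 < p" "p \<le> 1" and s: "0 < s" "s < 1" and \<alpha>: "0 < \<alpha>" and \<mu>: "0 < \<mu>" "\<alpha> * \<mu> \<le> p\<^sup>2 * s"
    and N: "\<mu>\<^sup>2 \<le> N" and R: "0 \<le> R" and d: "0 \<le> d"
    and e: "e \<le> 4 * R\<^sup>2" "e \<le> (1 - 2 * \<alpha> * \<mu>) * d\<^sup>2 + \<alpha>\<^sup>2 * (N / p ^ 3 * ((2 - p) * (R + d) + p * R)\<^sup>2)"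
  shows "e \<le> (1 - 2 * \<alpha> * \<mu> * (1 - s)) * d\<^sup>2 + \<alpha> * (4 * R\<^sup>2 * N / p ^ 3) / (\<mu> * (1 - s))"
proof -
  define y where "y = (2 - p) * (R + d) + p * R"
  have N0: "0 \<le> N" using N zero_le_power2[of \<mu>] by linarith
  show ?thesis
  proof (cases "s * (1 - s) * (2 * R + d)\<^sup>2 \<le> 4 * R\<^sup>2")
    case True
    have "p * y = 2 * p * R + p * (2 - p) * d" by (simp add: y_def algebra_simps)
    also have "\<dots> \<le> 2 * R + 1 * d"
    proof (rule add_mono)
      show "2 * p * R \<le> 2 * R" using p R mult_right_mono[of p 1 R] by simp
      have "p * (2 - p) \<le> 1" using zero_le_power2[of "1 - p"] by (simp add: power2_eq_square algebra_simps)
      then show "p * (2 - p) * d \<le> 1 * d" using d by (rule mult_right_mono)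
    qed
    finally have py: "p * y \<le> 2 * R + d" by simp
    have y0: "0 \<le> y" using p R d by (simp add: y_def)
    have "\<alpha> * \<mu> * (1 - s) * y\<^sup>2 \<le> p\<^sup>2 * s * (1 - s) * y\<^sup>2"
      using \<mu> s by (intro mult_right_mono) auto
    also have "\<dots> = s * (1 - s) * (p * y)\<^sup>2" by (simp add: power_mult_distrib)
    also have "\<dots> \<le> s * (1 - s) * (2 * R + d)\<^sup>2"
      using s py y0 p by (intro mult_left_mono power_mono) auto
    finally have "\<alpha> * \<mu> * (1 - s) * y\<^sup>2 \<le> 4 * R\<^sup>2" using True by linarith
    then have "\<alpha> * y\<^sup>2 \<le> 4 * R\<^sup>2 / (\<mu> * (1 - s))"
      using \<mu> s by (simp add: field_simps)
    then have "\<alpha> * N / p ^ 3 * (\<alpha> * y\<^sup>2) \<le> \<alpha> * N / p ^ 3 * (4 * R\<^sup>2 / (\<mu> * (1 - s)))"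
      using \<alpha> N0 p by (intro mult_left_mono) auto
    then have 1: "\<alpha>\<^sup>2 * (N / p ^ 3 * y\<^sup>2) \<le> \<alpha> * (4 * R\<^sup>2 * N / p ^ 3) / (\<mu> * (1 - s))"
      by (simp add: power2_eq_square mult_ac)
    have "(2 * \<alpha> * \<mu>) * (1 - s) \<le> 2 * \<alpha> * \<mu>"
      using \<alpha> \<mu> s by (intro mult_left_le) auto
    then have "(1 - 2 * \<alpha> * \<mu>) * d\<^sup>2 \<le> (1 - 2 * \<alpha> * \<mu> * (1 - s)) * d\<^sup>2"
      by (intro mult_right_mono) auto
    then show ?thesis using e(2) 1 unfolding y_def[symmetric] by linarith
  next
    case False
    define w where "w = \<alpha> * \<mu> * (1 - s)"
    have w0: "0 \<le> w" using \<alpha> \<mu> s by (simp add: w_def)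
    have "\<alpha> * \<mu> \<le> 1 * s" using \<mu>(2) p s
      by (meson mult_right_mono order_trans power_le_one less_imp_le)
    then have ws: "w \<le> s * (1 - s)" using s unfolding w_def by (intro mult_right_mono) auto
    have "s * (1 - s) \<le> 1 / 4" using zero_le_power2[of "s - 1 / 2"] by (simp add: power2_eq_square algebra_simps)
    then have "s * (1 - s) * (2 * R + d)\<^sup>2 \<le> 1 / 4 * (2 * R + d)\<^sup>2"
      by (rule mult_right_mono) simp
    then have "(4 * R)\<^sup>2 < (2 * R + d)\<^sup>2" using False by (simp add: power2_eq_square)
    then have d2: "2 * R < d" using R d by (smt (verit) power_mono)
    have h0: "4 * R\<^sup>2 \<le> d\<^sup>2" using power_mono[of "2 * R" d 2] d2 R by (simp add: power_mult_distrib)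
    have h1: "4 * R\<^sup>2 * (1 - 2 * s) \<le> (1 - s) * (1 - 2 * (s * (1 - s))) * d\<^sup>2"
    proof -
      have coeff: "(1 - s) * (1 - 2 * (s * (1 - s))) = 1 - 3 * s + 4 * s\<^sup>2 - 2 * s ^ 3"
        by (simp add: power2_eq_square power3_eq_cube algebra_simps)
      have c0: "0 \<le> (1 - s) * (1 - 2 * (s * (1 - s)))"
        using s \<open>s * (1 - s) \<le> 1 / 4\<close> by (intro mult_nonneg_nonneg) auto
      show ?thesis
      \<comment> \<open>For \<open>s \<ge> 1 - 1 / sqrt 2\<close>, hence for \<open>s \<ge> 3 / 10\<close>, \<open>2 * R < d\<close> is enough. Below \<open>3 / 10\<close> the case assumption
          forces \<open>d \<ge> 23 / 10 * R\<close>.\<close>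
      proof (cases "s < 3 / 10")
        case False
        have "0 \<le> s * ((4 * s - 2 * (s * s)) - 1)"
        proof -
          have "0 \<le> (s - 3 / 10) * (1 - s)" using False s by (intro mult_nonneg_nonneg) auto
          moreover have "(s - 3 / 10) * (1 - s) = 13 / 10 * s - 3 / 10 - s * s"
            by (simp add: field_simps)
          ultimately have "0 \<le> (4 * s - 2 * (s * s)) - 1" using False by linarith
          then show ?thesis using s by (intro mult_nonneg_nonneg) auto
        qed
        then have "1 - 2 * s \<le> (1 - s) * (1 - 2 * (s * (1 - s)))"
          unfolding coeff by (simp add: power2_eq_square power3_eq_cube algebra_simps)
        then have "(1 - 2 * s) * (4 * R\<^sup>2) \<le> (1 - s) * (1 - 2 * (s * (1 - s))) * (4 * R\<^sup>2)"
          by (rule mult_right_mono) simp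
        also have "\<dots> \<le> (1 - s) * (1 - 2 * (s * (1 - s))) * d\<^sup>2"
          using h0 c0 by (rule mult_left_mono)
        finally show ?thesis by (simp add: mult.commute)
      next
        case True
        have "s * (1 - s) \<le> 21 / 100"
        proof -
          have "0 \<le> (3 / 10 - s) * (7 / 10 - s)" using True by (intro mult_nonneg_nonneg) auto
          moreover have "(3 / 10 - s) * (7 / 10 - s) = 21 / 100 - s * (1 - s)"
            by (simp add: field_simps)
          ultimately show ?thesis by linarith
        qed
        then have "s * (1 - s) * (2 * R + d)\<^sup>2 \<le> 21 / 100 * (2 * R + d)\<^sup>2"
          by (rule mult_right_mono) simp
        then have sq: "4 * R\<^sup>2 < 21 / 100 * (2 * R + d)\<^sup>2" using False by linarith
        have "23 / 10 * R \<le> d"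
        proof (rule ccontr)
          assume "\<not> 23 / 10 * R \<le> d"
          then have "(2 * R + d)\<^sup>2 \<le> (43 / 10 * R)\<^sup>2" using R d by (intro power_mono) auto
          then show False using sq zero_le_power2[of R] by (simp add: power_mult_distrib power_divide)
        qed
        then have "(23 / 10 * R)\<^sup>2 \<le> d\<^sup>2" using R by (intro power_mono) auto
        then have d3: "529 / 100 * R\<^sup>2 \<le> d\<^sup>2" by (simp add: power_mult_distrib power_divide)
        have "s * s\<^sup>2 \<le> 3 / 10 * s\<^sup>2"
          using True by (intro mult_right_mono) auto
        then have s3: "s ^ 3 \<le> 3 / 10 * s\<^sup>2" by (simp add: power2_eq_square power3_eq_cube)
        \<comment> \<open>The tangent of \<open>s\<^sup>2\<close> near the minimum of the remaining quadratic makes the estimate linear in \<open>s\<close>.\<close>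
        have "(s - 21 / 100)\<^sup>2 = s\<^sup>2 - 42 / 100 * s + 441 / 10000"
          by (simp add: power2_eq_square field_simps)
        then have s2: "42 / 100 * s - 441 / 10000 \<le> s\<^sup>2"
          using zero_le_power2[of "s - 21 / 100"] by linarith
        have "4 * (1 - 2 * s) \<le> 529 / 100 * ((1 - s) * (1 - 2 * (s * (1 - s))))"
        proof -
          have "529 / 100 * (1 - 3 * s + 4 * s\<^sup>2 - 2 * s ^ 3)
              = 529 / 100 - 1587 / 100 * s + 2116 / 100 * s\<^sup>2 - 1058 / 100 * s ^ 3"
            by (simp add: field_simps)
          moreover have "4 * (1 - 2 * s) = 4 - 8 * s" by simp
          ultimately show ?thesis unfolding coeff using s3 s2 s by linarith
        qed
        then have "4 * (1 - 2 * s) * R\<^sup>2 \<le> 529 / 100 * ((1 - s) * (1 - 2 * (s * (1 - s)))) * R\<^sup>2"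
          by (rule mult_right_mono) simp
        moreover have "4 * R\<^sup>2 * (1 - 2 * s) = 4 * (1 - 2 * s) * R\<^sup>2" by simp
        ultimately have "4 * R\<^sup>2 * (1 - 2 * s) \<le> 529 / 100 * ((1 - s) * (1 - 2 * (s * (1 - s)))) * R\<^sup>2"
          by (simp only:)
        also have "\<dots> = (1 - s) * (1 - 2 * (s * (1 - s))) * (529 / 100 * R\<^sup>2)" by simp
        also have "\<dots> \<le> (1 - s) * (1 - 2 * (s * (1 - s))) * d\<^sup>2"
          using d3 c0 by (rule mult_left_mono)
        finally show ?thesis .
      qed
    qed
    \<comment> \<open>The right-hand side is affine in \<open>w\<close>, so it suffices to know it at 0 (\<open>h0\<close>) and at \<open>s * (1 - s)\<close> (\<open>h1\<close>).\<close>
    have "4 * R\<^sup>2 \<le> (1 - 2 * w) * d\<^sup>2 + w * (4 * R\<^sup>2 / (1 - s)\<^sup>2)"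
    proof (cases "2 * d\<^sup>2 \<le> 4 * R\<^sup>2 / (1 - s)\<^sup>2")
      case True
      then have "w * (2 * d\<^sup>2) \<le> w * (4 * R\<^sup>2 / (1 - s)\<^sup>2)" using w0 by (rule mult_left_mono)
      then show ?thesis using h0 by (simp add: algebra_simps)
    next
      case False
      then have "w * (2 * d\<^sup>2 - 4 * R\<^sup>2 / (1 - s)\<^sup>2) \<le> s * (1 - s) * (2 * d\<^sup>2 - 4 * R\<^sup>2 / (1 - s)\<^sup>2)"
        using ws by (intro mult_right_mono) auto
      moreover have "s * (1 - s) * (4 * R\<^sup>2 / (1 - s)\<^sup>2) = 4 * R\<^sup>2 * s / (1 - s)"
        using s by (simp add: power2_eq_square)
      moreover have "4 * R\<^sup>2 \<le> (1 - 2 * (s * (1 - s))) * d\<^sup>2 + 4 * R\<^sup>2 * s / (1 - s)"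
      proof -
        have "4 * R\<^sup>2 * (1 - 2 * s) / (1 - s) \<le> (1 - 2 * (s * (1 - s))) * d\<^sup>2"
          using h1 s by (simp add: pos_divide_le_eq mult_ac)
        moreover have "4 * R\<^sup>2 * (1 - 2 * s) / (1 - s) = 4 * R\<^sup>2 - 4 * R\<^sup>2 * s / (1 - s)"
          using s by (simp add: field_simps)
        ultimately show ?thesis by linarith
      qed
      ultimately show ?thesis by (simp add: algebra_simps)
    qed
    also have "w * (4 * R\<^sup>2 / (1 - s)\<^sup>2) = \<alpha> * (4 * R\<^sup>2 * \<mu>\<^sup>2) / (\<mu> * (1 - s))"
      using s \<mu> by (simp add: w_def power2_eq_square)
    also have "\<dots> \<le> \<alpha> * (4 * R\<^sup>2 * N / p ^ 3) / (\<mu> * (1 - s))"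
    proof -
      have "N * 1 \<le> N * (1 / p ^ 3)"
        using p N0 by (intro mult_left_mono) (auto simp: power_le_one)
      then have "4 * R\<^sup>2 * \<mu>\<^sup>2 \<le> 4 * R\<^sup>2 * (N / p ^ 3)"
        using N by (intro mult_left_mono) auto
      then show ?thesis using \<alpha> \<mu> s by (intro divide_right_mono mult_left_mono) auto
    qed
    finally show ?thesis using e(1) by (simp add: w_def mult.assoc)
  qed
qed

text \<open>The condition on \<open>S\<close> says \<open>r * S + v \<le> S\<close>, so this term survives each step of the recursion.\<close>

lemma contraction_recurrence:
  fixes e :: "nat \<Rightarrow> real"
  assumes r: "0 \<le> r" and first: "e 1 \<le> r * e 0 + S"
    and step: "\<And>t. t \<ge> 1 \<Longrightarrow> e (Suc t) \<le> r * e t + v" and S: "v \<le> (1 - r) * S" and t: "t \<ge> 1"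
  shows "e t \<le> r ^ t * e 0 + S"
  using t
proof (induction t rule: dec_induct)
  case base
  show ?case using first by simp
next
  case (step t)
  have "e (Suc t) \<le> r * e t + v" using assms(3) step(1) by simp
  also have "\<dots> \<le> r * (r ^ t * e 0 + S) + (1 - r) * S"
    using step(3) S r by (intro add_mono mult_left_mono) auto
  finally show ?case by (simp add: algebra_simps)
qed

lemma square_mean_le_mean_square:
  fixes x :: "'m::finite \<Rightarrow> real"
  shows "((\<Sum>i\<in>UNIV. x i) / real CARD('m))\<^sup>2 \<le> (\<Sum>i\<in>UNIV. (x i)\<^sup>2) / real CARD('m)"
proof -
  have "(\<Sum>i\<in>UNIV. 1 * x i)\<^sup>2 \<le> (\<Sum>i\<in>(UNIV :: 'm set). 1\<^sup>2) * (\<Sum>i\<in>UNIV. (x i)\<^sup>2)"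
    by (rule Cauchy_Schwarz_ineq_sum)
  then show ?thesis by (simp add: power_divide field_simps power2_eq_square)
qed

section \<open>Convergence of the algorithm\<close>

theorem corollary3:
  fixes A :: "('m::finite, 'l::finite mod_ring, 'n::finite) tensor"
    and B :: "('m, 'q::finite, 'n) tensor"
    and W :: "('l mod_ring, 'q, 'n) tensor set"
    and Xstar X0 :: "('l mod_ring, 'q, 'n) tensor"
    and p R K :: real
    and model :: missing_model
    and Q :: "('m, 'l mod_ring, 'n) tensor pmf"
    and M :: "'w measure"
    and I :: "nat \<Rightarrow> 'w \<Rightarrow> 'm"
    and D :: "nat \<Rightarrow> 'w \<Rightarrow> ('m, 'l mod_ring, 'n) tensor"
    and X :: "(nat \<Rightarrow> real) \<Rightarrow> nat \<Rightarrow> 'w \<Rightarrow> ('l mod_ring, 'q, 'n) tensor"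
    and G a_max L_g G_star :: real
  assumes p: "0 < p" "p < 1"
    and W: "closed W" "convex W"
    and Xstar: "Xstar \<in> W" "A \<star> Xstar = B"
    and mask: "missing_law model p Q"
    and M: "prob_space M"
    and rows: "row_assumption M I D Q"
    and R: "\<exists>W1\<in>W. norm W1 = R" "\<forall>W1\<in>W. norm W1 \<le> R"
    and K: "\<forall>W1\<in>W. \<forall>W2\<in>W. norm (W1 - W2) \<le> K"
    and X: "\<forall>\<alpha> t \<omega>. X \<alpha> t \<omega> =
      msgdt p (correction model) A B W X0 \<alpha> (\<lambda>s. I s \<omega>) (\<lambda>s. D s \<omega>) t"
    and G: "G =
      4 * real CARD('n) ^ 2 * R\<^sup>2 / (p ^ 3 * real CARD('m))
          * (\<Sum>i\<in>UNIV. norm (row_slice A i) ^ 4)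
      + 4 * real CARD('n) powr (3 / 2) * R / (p\<^sup>2 * real CARD('m))
          * (\<Sum>i\<in>UNIV. norm (row_slice A i) ^ 3 * norm (row_slice B i))
      + 2 * real CARD('n) / (p\<^sup>2 * real CARD('m))
          * (\<Sum>i\<in>UNIV. norm (row_slice A i) ^ 2 * norm (row_slice B i) ^ 2)"
    and a_max: "a_max = (MAX i. norm (row_slice A i))"
    and L_g: "L_g = real CARD('n) * a_max\<^sup>2 / p\<^sup>2"
    and G_star: "G_star =
      4 * real CARD('n) ^ 2 * R\<^sup>2 / (p ^ 3 * real CARD('m))
          * (\<Sum>i\<in>UNIV. norm (row_slice A i) ^ 4)"
  shows "(\<forall>C \<alpha>. C > 0 \<and> \<alpha> 0 > 0 \<and> (\<forall>t\<ge>1. \<alpha> t = C / sqrt (real t)) \<longrightarrow>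
            (\<forall>t\<ge>1. prob_space.expectation M (\<lambda>\<omega>. loss A B (X \<alpha> t \<omega>) - loss A B Xstar)
               \<le> (K\<^sup>2 / C + C * G) * ((2 + ln (real t)) / sqrt (real t)))) \<and>
         (\<forall>\<mu> \<alpha> r. \<mu> > 0 \<and> strongly_convex \<mu> (loss A B :: ('l mod_ring, 'q, 'n) tensor \<Rightarrow> real) \<and>
            0 < \<alpha> \<and> \<alpha> < 1 / L_g \<and> r = 1 - 2 * \<alpha> * \<mu> * (1 - \<alpha> * L_g) \<longrightarrow>
            (\<forall>t>0. prob_space.expectation M (\<lambda>\<omega>. (norm (X (\<lambda>_. \<alpha>) t \<omega> - Xstar))\<^sup>2)
               \<le> r ^ t * (norm (X0 - Xstar))\<^sup>2 + \<alpha> * G_star / (\<mu> * (1 - \<alpha> * L_g))))"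
proof -
  have mm: "mask_moments p (correction model) Q"
    using missing_law_moments[OF p mask] .
  have Q: "finite (set_pmf Q)" using mask_moments_finite[OF mm] .
  have W': "W \<noteq> {}" using Xstar by auto
  have R0: "R \<ge> 0" using R(1) norm_ge_zero by blast
  have loss_star: "loss A B Xstar = 0" by (simp add: loss_def Xstar)
  let ?g = "row_grad p (correction model) A B"
  let ?E = "\<lambda>t f. measure_pmf.expectation (replicate_pmf t (row_mask_law Q)) f"
  have transfer: "prob_space.expectation M (\<lambda>\<omega>. f (X \<alpha> t \<omega>)) = ?E t (\<lambda>h. f (sgd W ?g \<alpha> X0 h))"
    if "continuous_on UNIV f" for f :: "('l mod_ring, 'q, 'n) tensor \<Rightarrow> real" and \<alpha> t
    unfolding X[rule_format] by (rule expectation_msgdt[OF M rows Q W W' that])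
  have part1: "prob_space.expectation M (\<lambda>\<omega>. loss A B (X \<alpha> t \<omega>) - loss A B Xstar)
      \<le> (K\<^sup>2 / C + C * G) * ((2 + ln (real t)) / sqrt (real t))"
    if C: "C > 0" "\<forall>t\<ge>1. \<alpha> t = C / sqrt (real t)" and t: "t \<ge> 1" for C \<alpha> t
  proof -
    interpret projected_sgd W "row_mask_law Q" ?g \<alpha> X0 "loss_grad A B"
      by (rule projected_sgd_msgdt[OF p mm W W'])
    have "prob_space.expectation M (\<lambda>\<omega>. loss A B (X \<alpha> t \<omega>) - loss A B Xstar)
        = ?E t (\<lambda>h. loss A B (sgd W ?g \<alpha> X0 h)) - loss A B Xstar"
      using transfer[OF continuous_on_loss] by (simp add: loss_star)
    also have "\<dots> \<le> (K\<^sup>2 / C + C * G) * ((2 + ln (real t)) / sqrt (real t))"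
    proof (rule last_iterate_bound[OF C(1) _ _ _ _ Xstar(1) t])
      show "loss A B x + inner (loss_grad A B x) (y - x) \<le> loss A B y" for x y
        using loss_expansion[of A B y x] by simp
      show "measure_pmf.expectation (row_mask_law Q) (\<lambda>z. (norm (?g z x))\<^sup>2) \<le> G" if "x \<in> W" for x
        unfolding G using R(2) that by (intro second_moment_le_G[OF p mm]) auto
    qed (use C K in auto)
    finally show ?thesis .
  qed
  have part2: "prob_space.expectation M (\<lambda>\<omega>. (norm (X (\<lambda>_. \<alpha>) t \<omega> - Xstar))\<^sup>2)
      \<le> r ^ t * (norm (X0 - Xstar))\<^sup>2 + \<alpha> * G_star / (\<mu> * (1 - \<alpha> * L_g))"
    if \<mu>: "\<mu> > 0" "strongly_convex \<mu> (loss A B :: ('l mod_ring, 'q, 'n) tensor \<Rightarrow> real)"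
      and \<alpha>: "0 < \<alpha>" "\<alpha> < 1 / L_g" and r: "r = 1 - 2 * \<alpha> * \<mu> * (1 - \<alpha> * L_g)" and t: "t > 0"
    for \<mu> \<alpha> r t
  proof -
    interpret projected_sgd W "row_mask_law Q" ?g "\<lambda>_. \<alpha>" X0 "loss_grad A B"
      by (rule projected_sgd_msgdt[OF p mm W W'])
    define e where "e t = E t (\<lambda>h. (norm (iterate h - Xstar))\<^sup>2)" for t
    define N where "N = (real CARD('n))\<^sup>2 / real CARD('m) * (\<Sum>i\<in>UNIV. norm (row_slice A i) ^ 4)"
    define s where "s = \<alpha> * L_g"
    have G_N: "G_star = 4 * R\<^sup>2 * N / p ^ 3" by (simp add: G_star N_def mult_ac)
    have sc: "strongly_convex \<mu> (loss A (A \<star> Xstar) :: ('l mod_ring, 'q, 'n) tensor \<Rightarrow> real)"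
      using \<mu>(2) Xstar(2) by simp
    have \<mu>_le: "\<mu> \<le> real CARD('n) / real CARD('m) * (\<Sum>i\<in>UNIV. (norm (row_slice A i))\<^sup>2)"
      by (rule strongly_convex_loss_modulus_le[OF sc])
    have "(\<Sum>i\<in>UNIV. (norm (row_slice A i))\<^sup>2) \<le> (\<Sum>i\<in>(UNIV :: 'm set). a_max\<^sup>2)"
      unfolding a_max by (intro sum_mono power_mono Max_ge) auto
    then have "real CARD('n) / real CARD('m) * (\<Sum>i\<in>UNIV. (norm (row_slice A i))\<^sup>2)
        \<le> real CARD('n) / real CARD('m) * (real CARD('m) * a_max\<^sup>2)"
      by (intro mult_left_mono) auto
    also have "\<dots> = p\<^sup>2 * L_g" using p by (simp add: L_g)
    finally have \<mu>_L: "\<mu> \<le> p\<^sup>2 * L_g" using \<mu>_le by linarith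
    have L: "L_g > 0"
      using \<mu>(1) \<mu>_L p by (metis less_le_trans zero_less_mult_pos zero_less_power)
    have s: "0 < s" "s < 1" using \<alpha> L by (simp_all add: s_def field_simps)
    have \<alpha>\<mu>: "\<alpha> * \<mu> \<le> p\<^sup>2 * s"
      using mult_left_mono[OF \<mu>_L, of \<alpha>] \<alpha> by (simp add: s_def mult_ac)
    have "\<mu>\<^sup>2 \<le> (real CARD('n) * ((\<Sum>i\<in>UNIV. (norm (row_slice A i))\<^sup>2) / real CARD('m)))\<^sup>2"
      using \<mu>_le \<mu>(1) by (intro power_mono) auto
    also have "\<dots> = (real CARD('n))\<^sup>2 * ((\<Sum>i\<in>UNIV. (norm (row_slice A i))\<^sup>2) / real CARD('m))\<^sup>2"
      by (rule power_mult_distrib)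
    also have "\<dots> \<le> (real CARD('n))\<^sup>2 * ((\<Sum>i\<in>UNIV. ((norm (row_slice A i))\<^sup>2)\<^sup>2) / real CARD('m))"
      by (intro mult_left_mono square_mean_le_mean_square) simp
    also have "\<dots> = N" by (simp add: N_def flip: power_mult)
    finally have \<mu>_N: "\<mu>\<^sup>2 \<le> N" .
    have N0: "0 \<le> N" using \<mu>_N zero_le_power2[of \<mu>] by linarith
    have mono: "\<mu> * (norm (x - Xstar))\<^sup>2 \<le> inner (loss_grad A B x) (x - Xstar)" for x
    proof -
      have "inner (loss_grad A B x) (x - Xstar) = (norm (A \<star> (x - Xstar)))\<^sup>2 / real CARD('m)"
        unfolding inner_loss_grad by (simp add: power2_norm_eq_inner tprod_diff_right Xstar)
      then show ?thesis using strongly_convex_loss_norm_le[OF sc, of "x - Xstar"] by simp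
    qed
    have V_le: "V x \<le> N / p ^ 3 * ((2 - p) * norm x + p * R)\<^sup>2" for x
      using second_moment_consistent[OF p mm, of Xstar R A x] R(2) Xstar by (simp add: N_def)
    have V_le_G_star: "V x \<le> G_star" if "x \<in> W" for x
    proof -
      have "(2 - p) * norm x + p * R \<le> (2 - p) * R + p * R"
        using R(2) that p by (intro add_right_mono mult_left_mono) auto
      also have "\<dots> = 2 * R" by (simp add: algebra_simps)
      finally have "((2 - p) * norm x + p * R)\<^sup>2 \<le> (2 * R)\<^sup>2"
        using p R0 by (intro power_mono) auto
      then have "N / p ^ 3 * ((2 - p) * norm x + p * R)\<^sup>2 \<le> N / p ^ 3 * (2 * R)\<^sup>2"
        using N0 p by (intro mult_left_mono) auto
      also have "\<dots> = G_star" by (simp add: G_N power_mult_distrib mult_ac)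
      finally show ?thesis using V_le[of x] by linarith
    qed
    have rec: "e (Suc t) \<le> (1 - 2 * \<alpha> * \<mu>) * e t + \<alpha>\<^sup>2 * E t (\<lambda>h. V (iterate h))" for t
      unfolding e_def using \<alpha> by (intro strongly_monotone_step[OF mono Xstar(1)]) auto
    have r_ge: "1 - 2 * \<alpha> * \<mu> \<le> r"
      unfolding r s_def[symmetric] using \<alpha> \<mu> s mult_left_le[of "1 - s" "2 * \<alpha> * \<mu>"] by simp
    have "e t \<le> r ^ t * e 0 + \<alpha> * G_star / (\<mu> * (1 - \<alpha> * L_g))"
    proof (rule contraction_recurrence[where v = "\<alpha>\<^sup>2 * G_star"])
      \<comment> \<open>As \<open>\<alpha> * \<mu> \<le> s\<close>, even \<open>r \<ge> 1 / 2\<close>.\<close>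
      have "\<alpha> * \<mu> * (1 - s) \<le> 1 / 4"
      proof -
        have "\<alpha> * \<mu> \<le> 1 * s"
          using \<alpha>\<mu> p s by (meson mult_right_mono order_trans power_le_one less_imp_le)
        then have "\<alpha> * \<mu> * (1 - s) \<le> s * (1 - s)"
          using s by (intro mult_right_mono) auto
        also have "\<dots> \<le> 1 / 4"
          using zero_le_power2[of "s - 1 / 2"] by (simp add: power2_eq_square algebra_simps)
        finally show ?thesis .
      qed
      then show "0 \<le> r" unfolding r s_def by simp
      show "e 1 \<le> r * e 0 + \<alpha> * G_star / (\<mu> * (1 - \<alpha> * L_g))"
      proof -
        let ?d = "norm (X0 - Xstar)"
        have e0: "e 0 = ?d\<^sup>2" by (simp add: e_def)
        have "e 1 \<le> (1 - 2 * \<alpha> * \<mu> * (1 - s)) * ?d\<^sup>2 + \<alpha> * (4 * R\<^sup>2 * N / p ^ 3) / (\<mu> * (1 - s))"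
        proof (rule first_step_bound[OF p(1) _ s \<alpha>(1) \<mu>(1) \<alpha>\<mu> \<mu>_N R0])
          have "e 1 \<le> E 1 (\<lambda>_. 4 * R\<^sup>2)"
            unfolding e_def
          proof (rule E_mono)
            fix h :: "('m \<times> (1, 'l mod_ring, 'n) tensor) list" assume "length h = 1"
            then have "iterate h \<in> W" by (intro sgd_in) auto
            then have "norm (iterate h) \<le> R" "norm Xstar \<le> R" using R(2) Xstar by auto
            then have "norm (iterate h - Xstar) \<le> 2 * R"
              using norm_triangle_ineq4[of "iterate h" Xstar] by linarith
            then have "(norm (iterate h - Xstar))\<^sup>2 \<le> (2 * R)\<^sup>2" by (rule power_mono) simp
            then show "(norm (iterate h - Xstar))\<^sup>2 \<le> 4 * R\<^sup>2" by (simp add: power_mult_distrib)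
          qed
          then show "e 1 \<le> 4 * R\<^sup>2" by simp
          have "norm X0 \<le> R + ?d"
            using norm_triangle_ineq[of Xstar "X0 - Xstar"] R(2) Xstar by force
          then have "((2 - p) * norm X0 + p * R)\<^sup>2 \<le> ((2 - p) * (R + ?d) + p * R)\<^sup>2"
            using p R0 by (intro power_mono add_right_mono mult_left_mono) auto
          then have "N / p ^ 3 * ((2 - p) * norm X0 + p * R)\<^sup>2 \<le> N / p ^ 3 * ((2 - p) * (R + ?d) + p * R)\<^sup>2"
            using N0 p by (intro mult_left_mono) auto
          then have "V X0 \<le> N / p ^ 3 * ((2 - p) * (R + ?d) + p * R)\<^sup>2"
            using V_le[of X0] by linarith
          then have "\<alpha>\<^sup>2 * V X0 \<le> \<alpha>\<^sup>2 * (N / p ^ 3 * ((2 - p) * (R + ?d) + p * R)\<^sup>2)"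
            by (intro mult_left_mono) auto
          then show "e 1 \<le> (1 - 2 * \<alpha> * \<mu>) * ?d\<^sup>2 + \<alpha>\<^sup>2 * (N / p ^ 3 * ((2 - p) * (R + ?d) + p * R)\<^sup>2)"
            using rec[of 0] e0 by simp
        qed (use p in auto)
        then show ?thesis unfolding e0 r G_N s_def .
      qed
      show "e (Suc t) \<le> r * e t + \<alpha>\<^sup>2 * G_star" if "t \<ge> 1" for t
      proof -
        have "E t (\<lambda>h. V (iterate h)) \<le> E t (\<lambda>_. G_star)"
          by (rule E_mono, rule V_le_G_star, rule sgd_in) (use that in auto)
        then have "\<alpha>\<^sup>2 * E t (\<lambda>h. V (iterate h)) \<le> \<alpha>\<^sup>2 * G_star"
          by (intro mult_left_mono) auto
        moreover have "(1 - 2 * \<alpha> * \<mu>) * e t \<le> r * e t"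
          using r_ge by (rule mult_right_mono) (simp add: e_def)
        ultimately show ?thesis using rec[of t] by linarith
      qed
      have "(1 - r) * (\<alpha> * G_star / (\<mu> * (1 - s))) = 2 * (\<alpha>\<^sup>2 * G_star)"
        using s \<mu> unfolding r s_def[symmetric] by (simp add: power2_eq_square)
      moreover have "0 \<le> G_star" using N0 p by (simp add: G_N)
      then have "0 \<le> \<alpha>\<^sup>2 * G_star" by simp
      ultimately show "\<alpha>\<^sup>2 * G_star \<le> (1 - r) * (\<alpha> * G_star / (\<mu> * (1 - \<alpha> * L_g)))"
        unfolding s_def by linarith
    qed (use t in auto)
    moreover have "continuous_on UNIV (\<lambda>x. (norm (x - Xstar))\<^sup>2)"
      by (intro continuous_intros)
    note transfer[OF this, of "\<lambda>_. \<alpha>" t]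
    ultimately show ?thesis by (simp add: e_def)
  qed
  show ?thesis using part1 part2 by blast
qed

end
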